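(* The generating function $G(x,y)\equiv G(t,x,y,w)$ is algebraic. Moreover, writing $t=z(1-z)^3$ (with $z=z(t)=t+O(t^2)$ the corresponding formal power series), the series $G(1,1)$ satisfies $C(G(1,1),z,w)=0$, where $$\begin{aligned}C(h,z,w)={}&wz(-1+z)^9h^3+(-1+z)^6(2w^2z^2-w^2z+2z^2+w-z)h^2\\&-(-1+z)^3(w^2z^3-3w^2z^2-2wz^3+w^2z-2wz^2+z^3+5wz-3z^2-2w+z)h\\&+4wz^2-4wz+w.\end{aligned}$$
   Context: $G(x,y)=\sum_{n\ge0}t^n\sum_{(P,Q)\in\mathcal{I}_n}\sum_{i=0}^{2n}w^{P(i)}x^{\mathrm{contact}_{<i}(P)}y^{\mathrm{contact}_{\ge i}(P)}$, so that $G(1,1)=\sum_{n}t^n\sum_{(P,Q)\in\mathcal{I}_n}\sum_{i=0}^{2n}w^{P(i)}$. Here a Dyck path of size $n$ is a lattice path from $(0,0)$ to $(2n,0)$ with $n$ up-steps $(1,1)$ and $n$ down-steps $(1,-1)$ never going below height $0$; $P(i)$ is its height at abscissa $i$; a contact is a vertex on the $x$-axis, and $\mathrm{contact}_{<i}(P)$, $\mathrm{contact}_{\ge i}(P)$ count contacts with abscissa $<i$, resp. $\ge i$. The Tamari order is the reflexive transitive closure of the relation: if $P$ has a down-step $d$ immediately followed by an up-step and $\mathfrak{e}$ is the shortest excursion following $d$ (staying strictly above its starting height except at its last point), the path obtained by exchanging $d$ and $\mathfrak{e}$ is larger than $P$. $\mathcal{I}_n$ is the set of pairs $(P,Q)$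 of Dyck paths of size $n$ with $P\le Q$. *)

theory Defs
  imports "HOL-Computational_Algebra.Computational_Algebra"
begin

text \<open>Dyck paths are encoded as boolean lists: True = up-step (1,1), False = down-step (1,-1).\<close>

definition height :: "bool list \<Rightarrow> nat \<Rightarrow> int" where
  "height p i = int (length (filter id (take i p))) - int (length (filter Not (take i p)))"

definition dyck :: "nat \<Rightarrow> bool list \<Rightarrow> bool" where
  "dyck n p \<longleftrightarrow> length p = 2 * n \<and> height p (2 * n) = 0 \<and> (\<forall>i \<le> 2 * n. height p i \<ge> 0)"

definition excursion :: "bool list \<Rightarrow> bool" where
  "excursion e \<longleftrightarrow> e \<noteq> [] \<and> height e (length e) = 0 \<and>
     (\<forall>i. 0 < i \<and> i < length e \<longrightarrow> height e i > 0)"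

definition tamari_step :: "bool list \<Rightarrow> bool list \<Rightarrow> bool" where
  "tamari_step p q \<longleftrightarrow> (\<exists>A e B. p = A @ [False] @ e @ B \<and> q = A @ e @ [False] @ B \<and> excursion e)"

definition tamari_le :: "bool list \<Rightarrow> bool list \<Rightarrow> bool" where
  "tamari_le p q \<longleftrightarrow> tamari_step\<^sup>*\<^sup>* p q"

definition intervals :: "nat \<Rightarrow> (bool list \<times> bool list) set" where
  "intervals n = {(P, Q). dyck n P \<and> dyck n Q \<and> tamari_le P Q}"

definition contacts_lt :: "bool list \<Rightarrow> nat \<Rightarrow> nat" where
  "contacts_lt p i = card {j. j < i \<and> j \<le> length p \<and> height p j = 0}"

definition contacts_ge :: "bool list \<Rightarrow> nat \<Rightarrow> nat" where
  "contacts_ge p i = card {j. i \<le> j \<and> j \<le> length p \<and> height p j = 0}"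

text \<open>Coefficient ring \<open>\<int>[x,y,w]\<close> realised as nested polynomials: \<open>int poly poly poly\<close>,
  with w the innermost, y the middle and x the outermost variable.\<close>
type_synonym coeffring = "int poly poly poly"

definition varX :: coeffring where "varX = [:0, 1:]"
definition varY :: coeffring where "varY = [:[:0, 1:]:]"
definition varW :: coeffring where "varW = [:[:[:0, 1:]:]:]"

definition Gfun :: "coeffring fps" where
  "Gfun = Abs_fps (\<lambda>n. \<Sum>(P, Q) \<in> intervals n. \<Sum>i = 0..2 * n.
      varW ^ nat (height P i) * varX ^ contacts_lt P i * varY ^ contacts_ge P i)"

definition G11 :: "int poly fps" where
  "G11 = Abs_fps (\<lambda>n. poly (poly (fps_nth Gfun n) 1) 1)"

text \<open>Algebraicity of a power series F in t over a coefficient ring R (here \<open>\<int>[x,y,w]\<close>):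
  there is a nonzero polynomial P(h) with coefficients in R[t] such that P(F) = 0.
  (Equivalently algebraic over the fraction field Q(t,x,y,w), after clearing denominators.)\<close>
definition algebraic_fps :: "'a::comm_ring_1 fps \<Rightarrow> bool" where
  "algebraic_fps F \<longleftrightarrow> (\<exists>P :: 'a poly poly. P \<noteq> 0 \<and> poly (map_poly fps_of_poly P) F = 0)"

definition Cpoly :: "int poly fps \<Rightarrow> int poly fps \<Rightarrow> int poly fps \<Rightarrow> int poly fps" where
  "Cpoly h z w =
     w * z * (-1 + z) ^ 9 * h ^ 3
   + (-1 + z) ^ 6 * (2 * w^2 * z^2 - w^2 * z + 2 * z^2 + w - z) * h ^ 2
   - (-1 + z) ^ 3 * (w^2 * z^3 - 3 * w^2 * z^2 - 2 * w * z^3 + w^2 * z - 2 * w * z^2 + z^3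
                     + 5 * w * z - 3 * z^2 - 2 * w + z) * h
   + 4 * w * z^2 - 4 * w * z + w"

end

theory Submission imports Defs
begin

text \<open>The words below a nonempty Dyck word \<open>U Q1 D Q2\<close> in the Tamari order are the words
  \<open>U l D r P2\<close> with \<open>l r \<le> Q1\<close> and \<open>P2 \<le> Q2\<close>. Hence a nonempty interval amounts to two smaller
  intervals together with a splitting of the lower path of the first one, which gives functional
  equations for the series F(x) of intervals counted by contacts of the lower path and for G(x,y).
  The first is solved by a guessed rational parametrization, which is correct because the equation has
  a unique solution. The second is linear in G(x,y), G(1,y) and G(1,1). Substituting series X, Y in t
  for x, y that cancel the coefficients of both G(x,y) and G(1,y) expresses G(1,1) through F(X), F(Y)
  and Y; everything becomes rational in z and one more parameter, whose elimination is the cubic. For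
  the algebraicity of G, only the coefficient of G(x,y) is cancelled, by a series X(y): this
  gives G(1,y), and then the equation itself gives G(x,y), as rational functions of z, of the
  parameters of x and y, and of G(1,1), which are all algebraic.\<close>

section \<open>Dyck words and their heights\<close>

text \<open>Catalytic variables are forced by the splittings: a word can be cut at each of its
  contacts, and summing powers of x over the cuts turns x^k into a divided difference. Hence F(1),
  G(1,y) and G(1,1) join F(x) and G(x,y) as unknowns. The coefficient rings have no division.
  Divided differences and rational expressions are therefore stated multiplied by their
  denominators, and factors are cancelled in integral domains once they are known to be nonzero,
  mostly by a look at a constant coefficient. The parametrization also tames the kernel: for given
  v, the condition on u that cancels the coefficient of G(x,y) is linear, and eliminating u from
  both conditions leaves a fixed-point equation for v. Algebraicity is not propagated by resultants.
  All series are placed in one finite extension of the field of rational functions in t, which is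
  closed under the divisions that solve for G(1,y) and G(x,y).\<close>

inductive dyckp :: "bool list \<Rightarrow> bool" where
  Nil: "dyckp []"
| Cons: "dyckp a \<Longrightarrow> dyckp b \<Longrightarrow> dyckp (True # a @ False # b)"

definition final_height :: "bool list \<Rightarrow> int" where
  "final_height p = height p (length p)"

lemma final_height_simps [simp]:
  "final_height [] = 0"
  "final_height (True # p) = 1 + final_height p"
  "final_height (False # p) = final_height p - 1"
  "final_height (p @ q) = final_height p + final_height q"
  by (auto simp: final_height_def height_def)

lemma height_eq_final: "height p i = final_height (take i p)"
  by (simp add: height_def final_height_def min_def)

lemma height_0 [simp]: "height p 0 = 0"
  by (simp add: height_eq_final)

lemma height_Cons_Suc [simp]:
  "height (True # p) (Suc i) = 1 + height p i"
  "height (False # p) (Suc i) = height p i - 1"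
  by (simp_all add: height_eq_final)

lemma height_append_le: "i \<le> length p \<Longrightarrow> height (p @ q) i = height p i"
  by (simp add: height_eq_final)

lemma height_append_add [simp]: "height (p @ q) (length p + i) = final_height p + height q i"
  by (simp add: height_eq_final)

lemma height_append_Suc_add [simp]:
  "height (p @ q) (Suc (length p + i)) = final_height p + height q (Suc i)"
  using height_append_add[of p q "Suc i"] by simp

lemma dyckp_final_height [simp]: "dyckp p \<Longrightarrow> final_height p = 0"
  by (induction rule: dyckp.induct) auto

lemma dyckp_height_nonneg: "dyckp p \<Longrightarrow> height p i \<ge> 0"
proof (induction arbitrary: i rule: dyckp.induct)
  case Nil
  then show ?case by (simp add: height_def)
next
  case (Cons a b)
  show ?case
  proof (cases i)
    case (Suc j)
    show ?thesis
    proof (cases "j \<le> length a")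
      case True
      with Suc Cons show ?thesis by (simp add: height_append_le add_nonneg_nonneg)
    next
      case False
      then obtain k where "j = length a + Suc k"
        using less_iff_Suc_add[of "length a" j] by auto
      then have "height (True # a @ False # b) i = height b k"
        using Suc Cons by simp
      then show ?thesis using Cons by simp
    qed
  qed simp
qed

lemma dyckp_append: "dyckp p \<Longrightarrow> dyckp q \<Longrightarrow> dyckp (p @ q)"
  by (induction rule: dyckp.induct) (auto intro: dyckp.intros)

text \<open>Cutting at the first visit to a negative height isolates the down-step that closes the
  first arch of \<open>True # q\<close>.\<close>

lemma first_descent:
  assumes "final_height q < 0"
  obtains a b where "q = a @ False # b" "final_height a = 0" "\<And>i. height a i \<ge> 0"
proof -
  have ex: "height q (length q) < 0"
    using assms by (simp add: final_height_def)
  define i where "i = (LEAST i. height q i < 0)"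
  have i: "height q i < 0" unfolding i_def by (rule LeastI[of _ "length q"]) (rule ex)
  have ile: "i \<le> length q" unfolding i_def by (rule Least_le) (rule ex)
  have min: "height q j \<ge> 0" if "j < i" for j
    using not_less_Least[of j "\<lambda>i. height q i < 0"] that unfolding i_def by force
  obtain k where k: "i = Suc k" using i by (cases i) auto
  have klt: "k < length q" using ile k by simp
  have tk: "take i q = take k q @ [q ! k]" using klt k by (simp add: take_Suc_conv_app_nth)
  have hk: "height q k \<ge> 0" using min k by simp
  have qk: "\<not> q ! k"
    using i hk tk by (cases "q ! k") (auto simp: height_eq_final)
  have z: "final_height (take k q) = 0"
    using i hk tk qk by (auto simp: height_eq_final)
  have eq: "q = take k q @ False # drop (Suc k) q"
    using id_take_nth_drop[OF klt] qk by simp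
  have "height (take k q) j \<ge> 0" for j
    using min[of "min j k"] k by (auto simp: height_eq_final min_def)
  with eq z show ?thesis using that by blast
qed

lemma dyckp_if_heights:
  "final_height p = 0 \<Longrightarrow> (\<And>i. height p i \<ge> 0) \<Longrightarrow> dyckp p"
proof (induction p rule: length_induct)
  case (1 p)
  show ?case
  proof (cases p)
    case Nil
    then show ?thesis by (simp add: dyckp.Nil)
  next
    case (Cons s q)
    have s: s
      using 1(3)[of "Suc 0"] Cons by (cases s) (auto simp: height_eq_final)
    have "final_height q < 0" using 1(2) Cons s by simp
    then obtain a b where ab: "q = a @ False # b" "final_height a = 0" "\<And>i. height a i \<ge> 0"
      by (rule first_descent) blast
    have "height b i \<ge> 0" for i
      using 1(3)[of "Suc (length a + Suc i)"] ab Cons s by simp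
    moreover have "final_height b = 0" using 1(2) Cons s ab by simp
    ultimately have "dyckp a" "dyckp b" using 1(1) Cons ab by auto
    then show ?thesis using Cons s ab by (simp add: dyckp.Cons)
  qed
qed

lemma dyck_iff: "dyck n p \<longleftrightarrow> dyckp p \<and> length p = 2 * n"
proof
  assume d: "dyck n p"
  have "height p i \<ge> 0" for i
  proof (cases "i \<le> 2 * n")
    case False
    then have "height p i = height p (2 * n)"
      using d by (auto simp: dyck_def height_eq_final)
    then show ?thesis using d by (auto simp: dyck_def)
  qed (use d in \<open>auto simp: dyck_def\<close>)
  moreover have "final_height p = 0" using d by (simp add: dyck_def final_height_def)
  ultimately show "dyckp p \<and> length p = 2 * n"
    using dyckp_if_heights d by (auto simp: dyck_def)
next
  assume p: "dyckp p \<and> length p = 2 * n"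
  then have "height p (2 * n) = 0"
    using dyckp_final_height[of p] by (simp add: final_height_def)
  with p show "dyck n p" by (simp add: dyck_def dyckp_height_nonneg)
qed

lemma dyckp_even: "dyckp p \<Longrightarrow> even (length p)"
  by (induction rule: dyckp.induct) auto

text \<open>If \<open>a\<close> and \<open>a'\<close> differed, the longer one would begin with the
  shorter one followed by a down-step, and so reach height -1.\<close>

lemma dyckp_split_unique:
  assumes "dyckp a" "dyckp a'" "a @ False # b = a' @ False # b'"
  shows "a = a' \<and> b = b'"
proof -
  have no: "us = []" if "dyckp c" "dyckp (c @ us)" "us @ False # d' = False # d" for c us d d'
  proof (cases us)
    case (Cons s vs)
    then have "height (c @ us) (length c + Suc 0) < 0"
      using that by (simp only: height_append_add) (auto simp: height_eq_final)
    with dyckp_height_nonneg[OF that(2), of "length c + Suc 0"] show ?thesis by simp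
  qed
  from assms(3) obtain us where "a = a' @ us \<and> us @ False # b = False # b' \<or>
      a @ us = a' \<and> False # b = us @ False # b'"
    by (auto simp: append_eq_append_conv2)
  then show ?thesis
    using no[of a' us b b'] no[of a us b' b] assms by auto
qed

section \<open>A structural description of the Tamari order\<close>

text \<open>The Tamari exchange seen through the first-return decomposition: the moving down-step
  closes the first arch, lies inside it, or comes after it.\<close>

inductive dyck_step :: "bool list \<Rightarrow> bool list \<Rightarrow> bool" where
  here: "dyckp l \<Longrightarrow> dyckp m \<Longrightarrow> dyckp s \<Longrightarrow>
    dyck_step (True # l @ False # True # m @ False # s) (True # (l @ True # m @ [False]) @ False # s)"
| left: "dyck_step l l' \<Longrightarrow> dyckp s \<Longrightarrow> dyck_step (True # l @ False # s) (True # l' @ False # s)"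
| right: "dyck_step s s' \<Longrightarrow> dyckp l \<Longrightarrow> dyck_step (True # l @ False # s) (True # l @ False # s')"

lemma dyckp_arch: "dyckp m \<Longrightarrow> dyckp (True # m @ [False])"
  using dyckp.Cons[of m "[]"] dyckp.Nil by simp

lemma dyck_step_dyckp: "dyck_step p q \<Longrightarrow> dyckp p \<and> dyckp q"
proof (induction rule: dyck_step.induct)
  case (here l m s)
  have "dyckp (l @ True # m @ [False])"
    using dyckp_append[OF here(1) dyckp_arch[OF here(2)]] .
  from dyckp.Cons[OF this here(3)] dyckp.Cons[OF here(1) dyckp.Cons[OF here(2,3)]]
  show ?case by simp
qed (auto intro: dyckp.intros)

text \<open>The excursion and the first arch are both prefixes that return to height 0 for the first
  time at their end, so neither can be shorter than the other.\<close>

lemma excursion_prefix: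
  assumes "dyckp (e @ B)" "excursion e"
  obtains m where "dyckp m" "e = True # m @ [False]" "dyckp B"
proof -
  from assms obtain m s where ms: "e @ B = True # m @ False # s" "dyckp m" "dyckp s"
    by (cases rule: dyckp.cases) (auto simp: excursion_def)
  define d where "d = True # m @ [False]"
  have eB: "e @ B = d @ s" using ms by (simp add: d_def)
  have d0: "final_height d = 0" using ms by (simp add: d_def)
  have dpos: "height d i > 0" if i: "0 < i" "i < length d" for i
  proof -
    obtain j where j: "i = Suc j" using i by (cases i) auto
    then have "j \<le> length m" using i by (simp add: d_def)
    then have "height d i = 1 + height m j" using j by (simp add: d_def height_append_le)
    then show ?thesis using dyckp_height_nonneg[OF ms(2), of j] by simp
  qed
  have "length e = length d"
  proof (rule linorder_cases)
    assume lt: "length e < length d"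
    have "height e (length e) = height (e @ B) (length e)" by (simp add: height_append_le)
    also have "\<dots> = height d (length e)" using lt by (simp only: eB) (simp add: height_append_le)
    finally show ?thesis using dpos[of "length e"] lt assms(2) by (auto simp: excursion_def)
  next
    assume lt: "length d < length e"
    have "height e (length d) = height (e @ B) (length d)" using lt by (simp add: height_append_le)
    also have "\<dots> = final_height d" by (simp only: eB) (simp add: height_append_le final_height_def)
    finally show ?thesis using lt assms(2) d0 by (auto simp: excursion_def d_def)
  qed
  with eB have "e = d" "B = s" by auto
  then show ?thesis using that ms by (simp add: d_def)
qed

lemma tamari_step_imp_dyck_step:
  assumes "dyckp p" "p = A @ [False] @ e @ B" "excursion e"
  shows "dyck_step p (A @ e @ [False] @ B)"
  using assms
proof (induction arbitrary: A B rule: dyckp.induct)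
  case Nil
  then show ?case by simp
next
  case (Cons a b)
  then obtain A' where A: "A = True # A'" by (cases A) auto
  then have eq: "a @ False # b = A' @ False # e @ B" using Cons by simp
  then consider (1) us where "a = A' @ us" "us @ False # b = False # e @ B"
    | (2) us where "a @ us = A'" "False # b = us @ False # e @ B"
    by (auto simp: append_eq_append_conv2)
  then show ?case
  proof cases
    case 2
    show ?thesis
    proof (cases us)
      case Nil
      then have "b = e @ B" "A' = a" using 2 by auto
      moreover obtain m where "dyckp m" "e = True # m @ [False]" "dyckp B"
        using excursion_prefix Cons(2,6) calculation by blast
      ultimately show ?thesis
        using dyck_step.here[of a m B] Cons(1) A by simp
    next
      case (Cons s vs)
      then have b: "b = vs @ [False] @ e @ B" "A' = a @ False # vs" using 2 by auto
      from Cons.IH(2)[OF b(1) \<open>excursion e\<close>] show ?thesis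
        using dyck_step.right[of b _ a] \<open>dyckp a\<close> A b by simp
    qed
  next
    case 1
    show ?thesis
    proof (cases us)
      case Nil
      then have "b = e @ B" "A' = a" using 1 by auto
      moreover obtain m where "dyckp m" "e = True # m @ [False]" "dyckp B"
        using excursion_prefix Cons(2,6) calculation by blast
      ultimately show ?thesis
        using dyck_step.here[of a m B] Cons(1) A by simp
    next
      case (Cons s a2)
      then have a: "a = A' @ False # a2" and eB: "a2 @ False # b = e @ B" using 1 by auto
      have "height a (length A' + Suc 0) \<ge> 0" using dyckp_height_nonneg \<open>dyckp a\<close> by blast
      then have "final_height A' \<ge> 1" unfolding a height_append_add by simp
      moreover have "final_height a = 0" using \<open>dyckp a\<close> by simp
      ultimately have a2: "final_height a2 \<le> 0" using a by simp
      \<comment> \<open>The exchanged down-step lies inside the first arch, and \<open>a2\<close>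
        ends no higher than it starts. An excursion reaching beyond \<open>a2\<close> would use the
        closing down-step of the arch and fall below its own start, so it has to end inside
        \<open>a2\<close>.\<close>
      have "length e \<le> length a2"
      proof (rule ccontr)
        assume "\<not> ?thesis"
        then have l: "Suc (length a2) \<le> length e" by simp
        have "height e (length a2 + Suc 0) = height (e @ B) (length a2 + Suc 0)"
          using l by (simp add: height_append_le)
        also have "\<dots> < 0" unfolding eB[symmetric] height_append_add using a2 by simp
        finally show False using \<open>excursion e\<close> l
          by (cases "Suc (length a2) = length e") (auto simp: excursion_def dest: spec[of _ "Suc (length a2)"])
      qed
      then obtain B' where B': "a2 = e @ B'" "B = B' @ False # b"
        using eB by (auto simp: append_eq_append_conv2)
      from Cons.IH(1)[of A' B'] show ?thesis
        using dyck_step.left[of a "A' @ e @ [False] @ B'" b] a B' A \<open>dyckp b\<close> \<open>excursion e\<close> by simp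
    qed
  qed
qed

text \<open>This turns out to be the Tamari order on Dyck words.\<close>

inductive tle :: "bool list \<Rightarrow> bool list \<Rightarrow> bool" where
  Nil: "tle [] []"
| Cons: "dyckp l \<Longrightarrow> dyckp r \<Longrightarrow> tle (l @ r) q1 \<Longrightarrow> tle p2 q2 \<Longrightarrow>
    tle (True # l @ False # r @ p2) (True # q1 @ False # q2)"

lemma tle_dyckp: "tle p q \<Longrightarrow> dyckp p \<and> dyckp q"
  by (induction rule: tle.induct) (auto intro!: dyckp.intros dyckp_append)

lemma tle_length: "tle p q \<Longrightarrow> length p = length q"
  by (induction rule: tle.induct) auto

lemma tle_refl: "dyckp p \<Longrightarrow> tle p p"
proof (induction rule: dyckp.induct)
  case (Cons a b)
  then show ?case using tle.Cons[of a "[]" a b b] dyckp.Nil by simp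
qed (rule tle.Nil)

lemma dyck_step_append_right: "dyck_step p q \<Longrightarrow> dyckp r \<Longrightarrow> dyck_step (p @ r) (q @ r)"
proof (induction rule: dyck_step.induct)
  case (here l m s)
  then show ?case using dyck_step.here[of l m "s @ r"] dyckp_append by simp
next
  case (left l l' s)
  then show ?case using dyck_step.left[of l l' "s @ r"] dyckp_append by simp
next
  case (right s s' l)
  then show ?case using dyck_step.right[of "s @ r" "s' @ r" l] by simp
qed

text \<open>It is the target that is cut. At the top level an exchange merges two neighbouring
  arches, and the merged arch lies in one factor, hence so do its two sources. Cutting the source
  instead would fail: a step may move the first arch of \<open>p\<close> into the last arch of
  \<open>r\<close>.\<close>

lemma dyck_step_into_append:
  assumes "dyckp r" "dyckp p" "dyck_step s (r @ p)"
  shows "(\<exists>r0. s = r0 @ p \<and> dyck_step r0 r) \<or> (\<exists>p0. s = r @ p0 \<and> dyck_step p0 p)"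
  using assms
proof (induction arbitrary: s rule: dyckp.induct)
  case Nil
  then show ?case by simp
next
  case (Cons a b)
  have bp: "dyckp (b @ p)" using Cons dyckp_append by blast
  from Cons(6) show ?case
  proof cases
    case (here l m s')
    have "dyckp (l @ True # m @ [False])"
      using dyckp_append[OF here(3) dyckp_arch[OF here(4)]] .
    from dyckp_split_unique[OF Cons(1) this, of "b @ p" s'] here
    have e: "a = l @ True # m @ [False]" "s' = b @ p" by auto
    then have "s = (True # l @ False # True # m @ False # b) @ p" using here by simp
    moreover have "dyck_step (True # l @ False # True # m @ False # b) (True # a @ False # b)"
      using dyck_step.here[OF here(3,4) \<open>dyckp b\<close>] e by simp
    ultimately show ?thesis by (auto simp: append_assoc)
  next
    case (left l l' s')
    from dyckp_split_unique[OF Cons(1), of l' "b @ p" s'] left dyck_step_dyckp[of l l']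
    have e: "a = l'" "s' = b @ p" by auto
    then have "s = (True # l @ False # b) @ p" using left by simp
    moreover have "dyck_step (True # l @ False # b) (True # a @ False # b)"
      using dyck_step.left left e \<open>dyckp b\<close> by blast
    ultimately show ?thesis by (auto simp: append_assoc)
  next
    case (right s0 s' l)
    from dyckp_split_unique[OF Cons(1) \<open>dyckp l\<close>, of "b @ p" s'] right
    have e: "a = l" "s' = b @ p" by auto
    then have "(\<exists>r0. s0 = r0 @ p \<and> dyck_step r0 b) \<or> (\<exists>p0. s0 = b @ p0 \<and> dyck_step p0 p)"
      using Cons right by blast
    then show ?thesis
    proof
      assume "\<exists>r0. s0 = r0 @ p \<and> dyck_step r0 b"
      then obtain r0 where "s0 = r0 @ p" "dyck_step r0 b" by blast
      then have "s = (True # a @ False # r0) @ p" "dyck_step (True # a @ False # r0) (True # a @ False # b)"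
        using right e dyck_step.right \<open>dyckp a\<close> by auto
      then show ?thesis by blast
    next
      assume "\<exists>p0. s0 = b @ p0 \<and> dyck_step p0 p"
      then show ?thesis using right e by auto
    qed
  qed
qed

text \<open>Going down by one step preserves the shape U l D r p2: undoing a \<open>here\<close>
  step moves the last arch of \<open>l\<close> to the front of \<open>r\<close> and leaves
  \<open>l @ r\<close> unchanged, and every other step acts inside \<open>l\<close>,
  \<open>r\<close> or \<open>p2\<close>.\<close>

lemma dyck_step_tle: "tle p' q \<Longrightarrow> dyck_step p p' \<Longrightarrow> tle p q"
proof (induction arbitrary: p rule: tle.induct)
  case Nil
  then show ?case by cases
next
  case (Cons l r q1 p2 q2)
  have p2: "dyckp p2" using tle_dyckp Cons by blast
  from Cons(7) show ?case
  proof cases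
    case (here l0 m s)
    have "dyckp (l0 @ True # m @ [False])"
      using dyckp_append[OF here(3) dyckp_arch[OF here(4)]] .
    from dyckp_split_unique[OF Cons(1) this, of "r @ p2" s] here
    have e: "l = l0 @ True # m @ [False]" "s = r @ p2" by auto
    then have "p = True # l0 @ False # (True # m @ False # r) @ p2" using here by simp
    then show ?thesis
      using tle.Cons[of l0 "True # m @ False # r" q1 p2 q2] e here Cons(2-4) dyckp.Cons by simp
  next
    case (left l0 l' s)
    from dyckp_split_unique[OF Cons(1), of l' "r @ p2" s] left dyck_step_dyckp[of l0 l']
    have e: "l = l'" "s = r @ p2" by auto
    then have "tle (l0 @ r) q1" using Cons dyck_step_append_right left by blast
    then show ?thesis
      using tle.Cons[of l0 r q1 p2 q2] e left Cons dyck_step_dyckp by auto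
  next
    case (right s0 s' l0)
    from dyckp_split_unique[OF Cons(1) \<open>dyckp l0\<close>, of "r @ p2" s'] right
    have e: "l = l0" "s' = r @ p2" by auto
    then have "(\<exists>r0. s0 = r0 @ p2 \<and> dyck_step r0 r) \<or> (\<exists>p0. s0 = r @ p0 \<and> dyck_step p0 p2)"
      using dyck_step_into_append Cons right p2 by blast
    then show ?thesis
    proof
      assume "\<exists>r0. s0 = r0 @ p2 \<and> dyck_step r0 r"
      then obtain r0 where r0: "s0 = r0 @ p2" "dyck_step r0 r" by blast
      have "dyck_step (l @ r0) (l @ r)"
        using Cons(1) r0(2)
      proof (induction rule: dyckp.induct)
        case (Cons a b)
        then show ?case using dyck_step.right[of "b @ r0" "b @ r" a] by simp
      qed simp
      then have "tle (l @ r0) q1" using Cons by blast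
      then show ?thesis
        using tle.Cons[of l r0 q1 p2 q2] r0 e right Cons dyck_step_dyckp by auto
    next
      assume "\<exists>p0. s0 = r @ p0 \<and> dyck_step p0 p2"
      then obtain p0 where "s0 = r @ p0" "dyck_step p0 p2" by blast
      then show ?thesis
        using tle.Cons[of l r q1 p0 q2] e right Cons by auto
    qed
  qed
qed

lemma tamari_le_imp_tle:
  assumes "tamari_le p q" "dyckp p"
  shows "tle p q"
proof -
  have "tamari_step\<^sup>*\<^sup>* p q" using assms by (simp add: tamari_le_def)
  then show ?thesis using assms(2)
  proof (induction rule: converse_rtranclp_induct)
    case base
    then show ?case by (rule tle_refl)
  next
    case (step p p')
    then have "dyck_step p p'"
      unfolding tamari_step_def using tamari_step_imp_dyck_step by blast
    then show ?case using step dyck_step_tle dyck_step_dyckp by blast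
  qed
qed

section \<open>The structural order is contained in the Tamari order\<close>

lemma tamari_le_trans: "tamari_le p q \<Longrightarrow> tamari_le q r \<Longrightarrow> tamari_le p r"
  by (simp add: tamari_le_def)

lemma tamari_le_context: "tamari_le p q \<Longrightarrow> tamari_le (A @ p @ B) (A @ q @ B)"
  unfolding tamari_le_def
proof (induction rule: rtranclp_induct)
  case (step q r)
  then obtain A' e B' where "q = A' @ [False] @ e @ B'" "r = A' @ e @ [False] @ B'" "excursion e"
    by (auto simp: tamari_step_def)
  then have "tamari_step (A @ q @ B) (A @ r @ B)"
    unfolding tamari_step_def
    by (intro exI[of _ "A @ A'"] exI[of _ e] exI[of _ "B' @ B"]) simp
  with step show ?case by simp
qed simp

lemma excursion_arch:
  assumes "dyckp m"
  shows "excursion (True # m @ [False])"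
  unfolding excursion_def
proof (intro conjI allI impI)
  have "final_height (True # m @ [False]) = 0" using assms by simp
  then show "height (True # m @ [False]) (length (True # m @ [False])) = 0"
    unfolding final_height_def .
  fix i assume i: "0 < i \<and> i < length (True # m @ [False])"
  then obtain j where "i = Suc j" "j \<le> length m" by (cases i) auto
  then show "height (True # m @ [False]) i > 0"
    using dyckp_height_nonneg[OF assms, of j] by (simp add: height_append_le)
qed simp

text \<open>One exchange for each arch of \<open>r\<close>. These are not Dyck words; the order
  makes sense on all words, which is what allows it to be used inside a context.\<close>

lemma tamari_le_move_down: "dyckp r \<Longrightarrow> tamari_le (False # r) (r @ [False])"
proof (induction rule: dyckp.induct)
  case Nil
  then show ?case by (simp add: tamari_le_def)
next
  case (Cons a b)
  have "tamari_step (False # True # a @ False # b) ((True # a @ [False]) @ [False] @ b)"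
    unfolding tamari_step_def using excursion_arch[OF Cons(1)]
    by (intro exI[of _ "[]"] exI[of _ "True # a @ [False]"] exI[of _ b]) simp
  moreover have "tamari_le ((True # a @ [False]) @ (False # b) @ []) ((True # a @ [False]) @ (b @ [False]) @ [])"
    using Cons tamari_le_context by blast
  ultimately show ?case by (simp add: tamari_le_def)
qed

text \<open>Carrying the closing down-step past \<open>r\<close> turns U l D r p2 into U l r D p2;
  then \<open>l @ r\<close> is raised to \<open>q1\<close> and \<open>p2\<close> to
  \<open>q2\<close>.\<close>

lemma tle_imp_tamari_le: "tle p q \<Longrightarrow> tamari_le p q"
proof (induction rule: tle.induct)
  case Nil
  then show ?case by (simp add: tamari_le_def)
next
  case (Cons l r q1 p2 q2)
  have 1: "tamari_le ((True # l) @ (False # r) @ p2) ((True # l) @ (r @ [False]) @ p2)"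
    using tamari_le_context tamari_le_move_down Cons by blast
  have 2: "tamari_le ([True] @ (l @ r) @ ([False] @ p2)) ([True] @ q1 @ ([False] @ p2))"
    using tamari_le_context Cons by blast
  have 3: "tamari_le ((True # q1 @ [False]) @ p2 @ []) ((True # q1 @ [False]) @ q2 @ [])"
    using tamari_le_context Cons by blast
  from tamari_le_trans[OF tamari_le_trans[of _ _ "[True] @ q1 @ [False] @ p2"], of "True # l @ False # r @ p2"] 1 2 3
  show ?case by simp
qed

lemma intervals_eq: "intervals n = {(p, q). tle p q \<and> length p = 2 * n}"
proof -
  have "dyck n p \<and> dyck n q \<and> tamari_le p q \<longleftrightarrow> tle p q \<and> length p = 2 * n" for p q
    using tamari_le_imp_tle[of p q] tle_imp_tamari_le[of p q] tle_dyckp[of p q] tle_length[of p q]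
    by (auto simp: dyck_iff)
  then show ?thesis by (simp add: intervals_def)
qed

lemma finite_intervals [simp]: "finite (intervals n)"
proof (rule finite_subset)
  show "intervals n \<subseteq> {p. length p = 2 * n} \<times> {p. length p = 2 * n}"
    by (auto simp: intervals_def dyck_def)
  show "finite ({p :: bool list. length p = 2 * n} \<times> {p :: bool list. length p = 2 * n})"
    using finite_lists_length_eq[of "UNIV :: bool set" "2 * n"] by simp
qed

section \<open>Contacts and pointed weights\<close>

definition zeros :: "bool list \<Rightarrow> nat set" where
  "zeros p = {j. j \<le> length p \<and> height p j = 0}"

text \<open>Leaving out the starting point makes this count additive under concatenation, where the
  junction is a contact of both factors.\<close>

definition returns :: "bool list \<Rightarrow> nat" where
  "returns p = card (zeros p) - 1"

definition pointed_weight :: "'a \<Rightarrow> 'a \<Rightarrow> 'a \<Rightarrow> bool list \<Rightarrow> 'a::comm_ring_1" where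
  "pointed_weight x y w p = (\<Sum>i = 0..length p.
     w ^ nat (height p i) * x ^ contacts_lt p i * y ^ contacts_ge p i)"

lemma finite_zeros [simp]: "finite (zeros p)"
  by (rule finite_subset[of _ "{..length p}"]) (auto simp: zeros_def)

lemma zero_in_zeros [simp]: "0 \<in> zeros p"
  by (simp add: zeros_def)

lemma card_zeros: "card (zeros p) = Suc (returns p)"
proof -
  have "zeros p \<noteq> {}" using zero_in_zeros by blast
  then show ?thesis unfolding returns_def using card_gt_0_iff[of "zeros p"] by simp
qed

lemma contacts_lt_eq: "contacts_lt p i = card {j \<in> zeros p. j < i}"
  unfolding contacts_lt_def zeros_def by (rule arg_cong[of _ _ card]) auto

lemma contacts_ge_eq: "contacts_ge p i = card {j \<in> zeros p. i \<le> j}"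
  unfolding contacts_ge_def zeros_def by (rule arg_cong[of _ _ card]) auto

context
  fixes a b p :: "bool list"
  assumes a: "dyckp a"
  defines "p \<equiv> True # a @ False # b"
begin

lemma height_arch_inside: "j \<le> length a \<Longrightarrow> height p (Suc j) = 1 + height a j"
  by (simp add: p_def height_append_le)

lemma height_arch_after: "height p (length a + 2 + j) = height b j"
  using a by (simp add: p_def)

lemma zeros_arch: "zeros p = insert 0 ((\<lambda>j. length a + 2 + j) ` zeros b)"
proof (intro set_eqI iffI)
  fix i assume i: "i \<in> zeros p"
  show "i \<in> insert 0 ((\<lambda>j. length a + 2 + j) ` zeros b)"
  proof (cases i)
    case (Suc j)
    have "\<not> j \<le> length a"
    proof
      assume "j \<le> length a"
      with i Suc show False
        using height_arch_inside[of j] dyckp_height_nonneg[OF a, of j] by (simp add: zeros_def)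
    qed
    then obtain k where "i = length a + 2 + k"
      using Suc less_iff_Suc_add[of "length a" j] by auto
    with i show ?thesis
      using height_arch_after[of k] by (auto simp: zeros_def p_def)
  qed simp
next
  fix i assume "i \<in> insert 0 ((\<lambda>j. length a + 2 + j) ` zeros b)"
  then show "i \<in> zeros p"
    using height_arch_after by (auto simp: zeros_def p_def)
qed

lemma returns_arch: "returns p = Suc (returns b)"
proof -
  have "card (zeros p) = Suc (card (zeros b))"
    unfolding zeros_arch by (subst card_insert_disjoint) (auto simp: card_image inj_on_def)
  then show ?thesis by (simp add: card_zeros)
qed

lemma contacts_arch:
  "contacts_lt p 0 = 0" "contacts_ge p 0 = Suc (Suc (returns b))"
  "j \<le> length a \<Longrightarrow> contacts_lt p (Suc j) = 1"
  "j \<le> length a \<Longrightarrow> contacts_ge p (Suc j) = Suc (returns b)"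
  "contacts_lt p (length a + 2 + j) = Suc (contacts_lt b j)"
  "contacts_ge p (length a + 2 + j) = contacts_ge b j"
proof -
  have inj: "inj_on (\<lambda>j. length a + 2 + j) A" for A by (auto simp: inj_on_def)
  show "contacts_lt p 0 = 0" by (simp add: contacts_lt_eq)
  have "{j \<in> zeros p. 0 \<le> j} = zeros p" by auto
  then show "contacts_ge p 0 = Suc (Suc (returns b))"
    by (simp only: contacts_ge_eq card_zeros returns_arch)
  show "contacts_lt p (Suc j) = 1" if "j \<le> length a"
  proof -
    have "{i \<in> zeros p. i < Suc j} = {0}" using that by (auto simp: zeros_arch)
    then show ?thesis by (simp add: contacts_lt_eq)
  qed
  show "contacts_ge p (Suc j) = Suc (returns b)" if "j \<le> length a"
  proof -
    have "{i \<in> zeros p. Suc j \<le> i} = (\<lambda>j. length a + 2 + j) ` zeros b"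
      using that by (auto simp: zeros_arch)
    then show ?thesis by (simp only: contacts_ge_eq card_image[OF inj] card_zeros)
  qed
  have "{i \<in> zeros p. i < length a + 2 + j} =
      insert 0 ((\<lambda>j. length a + 2 + j) ` {i \<in> zeros b. i < j})"
    by (auto simp: zeros_arch)
  then show "contacts_lt p (length a + 2 + j) = Suc (contacts_lt b j)"
    unfolding contacts_lt_eq by (simp only:) (subst card_insert_disjoint, auto simp: card_image[OF inj, simplified])
  have "{i \<in> zeros p. length a + 2 + j \<le> i} = (\<lambda>j. length a + 2 + j) ` {i \<in> zeros b. j \<le> i}"
    by (auto simp: zeros_arch)
  then show "contacts_ge p (length a + 2 + j) = contacts_ge b j"
    by (simp only: contacts_ge_eq card_image[OF inj])
qed

text \<open>The three contributions come from the origin, from the points on the arch above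
  \<open>a\<close> (one contact to the left, one more unit of height) and from the points of
  \<open>b\<close>.\<close>

lemma pointed_weight_arch:
  "pointed_weight x y w p =
     y ^ Suc (returns b) * (y + w * x * pointed_weight 1 1 w a) + x * pointed_weight x y w b"
proof -
  let ?f = "\<lambda>i. w ^ nat (height p i) * x ^ contacts_lt p i * y ^ contacts_ge p i"
  have len: "length p = Suc (length a + 1 + length b)" by (simp add: p_def)
  have 1: "?f 0 = y ^ Suc (returns b) * y" by (simp add: contacts_arch)
  have 2: "(\<Sum>i\<le>length a. ?f (Suc i)) = y ^ Suc (returns b) * (w * x * pointed_weight 1 1 w a)"
  proof -
    have "?f (Suc i) = y ^ Suc (returns b) * (w * x * w ^ nat (height a i))" if "i \<le> length a" for i
    proof -
      have "nat (height p (Suc i)) = Suc (nat (height a i))"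
        using height_arch_inside[OF that] dyckp_height_nonneg[OF a, of i] by simp
      then show ?thesis using that by (simp add: contacts_arch algebra_simps)
    qed
    then show ?thesis
      by (simp add: pointed_weight_def sum_distrib_left atLeast0AtMost del: power_Suc)
  qed
  have 3: "(\<Sum>i\<le>length b. ?f (length a + 2 + i)) = x * pointed_weight x y w b"
    unfolding pointed_weight_def sum_distrib_left atLeast0AtMost contacts_arch height_arch_after
    by (simp add: algebra_simps)
  have "{..length p} = insert 0 (Suc ` {..length a} \<union> (\<lambda>i. length a + 2 + i) ` {..length b})"
    (is "?A = ?B")
  proof (intro set_eqI iffI)
    fix i assume i: "i \<in> ?A"
    consider "i = 0" | "i \<noteq> 0" "i \<le> Suc (length a)" | "i \<ge> length a + 2" by linarith
    then show "i \<in> ?B"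
    proof cases
      case 2
      then show ?thesis by (cases i) auto
    next
      case 3
      then show ?thesis using i len by (auto intro!: image_eqI[of _ _ "i - (length a + 2)"])
    qed simp
  qed (auto simp: len)
  then have "pointed_weight x y w p = sum ?f (insert 0 (Suc ` {..length a} \<union> (\<lambda>i. length a + 2 + i) ` {..length b}))"
    by (simp only: pointed_weight_def atLeast0AtMost)
  also have "\<dots> = ?f 0 + sum ?f (Suc ` {..length a} \<union> (\<lambda>i. length a + 2 + i) ` {..length b})"
    by (subst sum.insert) auto
  also have "sum ?f (Suc ` {..length a} \<union> (\<lambda>i. length a + 2 + i) ` {..length b})
      = sum ?f (Suc ` {..length a}) + sum ?f ((\<lambda>i. length a + 2 + i) ` {..length b})"
    by (subst sum.union_disjoint) auto
  also have "sum ?f (Suc ` {..length a}) = (\<Sum>i\<le>length a. ?f (Suc i))"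
    by (subst sum.reindex) auto
  also have "sum ?f ((\<lambda>i. length a + 2 + i) ` {..length b}) = (\<Sum>i\<le>length b. ?f (length a + 2 + i))"
    by (subst sum.reindex) (auto simp: inj_on_def)
  finally show ?thesis unfolding 1 2 3 by (simp only: algebra_simps)
qed

end

lemma zeros_Nil [simp]: "zeros [] = {0}"
  by (auto simp: zeros_def)

lemma returns_Nil [simp]: "returns [] = 0"
  by (simp add: returns_def)

lemma pointed_weight_Nil [simp]: "pointed_weight x y w [] = y"
  by (simp add: pointed_weight_def contacts_lt_eq contacts_ge_eq card_zeros)

lemma returns_append: "dyckp p \<Longrightarrow> dyckp q \<Longrightarrow> returns (p @ q) = returns p + returns q"
proof (induction rule: dyckp.induct)
  case (Cons a b)
  then show ?case using returns_arch[of a "b @ q"] returns_arch[of a b] by simp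
qed simp

text \<open>The junction belongs to both factors. It is counted with \<open>p\<close>, so the term
  of \<open>q\<close> at its starting point, \<open>y ^ Suc (returns q)\<close>, is taken
  away.\<close>

lemma pointed_weight_append:
  "dyckp p \<Longrightarrow> dyckp q \<Longrightarrow> pointed_weight x y w (p @ q) =
     y ^ returns q * pointed_weight x y w p
     + x ^ returns p * (pointed_weight x y w q - y ^ Suc (returns q))"
proof (induction rule: dyckp.induct)
  case (Cons a b)
  have IH: "pointed_weight x y w (b @ q) = y ^ returns q * pointed_weight x y w b
      + x ^ returns b * (pointed_weight x y w q - y ^ Suc (returns q))"
    using Cons by blast
  show ?case
    using pointed_weight_arch[OF Cons(1), where b = "b @ q" and x = x and y = y and w = w]
      pointed_weight_arch[OF Cons(1), where b = b and x = x and y = y and w = w]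
      returns_arch[OF Cons(1), of b] returns_append[OF Cons(2,5)]
    by (simp add: IH power_add) (simp add: algebra_simps)
qed (simp add: algebra_simps)

section \<open>Splittings of a Dyck word\<close>

definition splits :: "bool list \<Rightarrow> (bool list \<times> bool list) set" where
  "splits p = {(l, r). p = l @ r \<and> dyckp l \<and> dyckp r}"

lemma finite_splits [simp]: "finite (splits p)"
proof (rule finite_subset)
  show "splits p \<subseteq> (\<lambda>i. (take i p, drop i p)) ` {..length p}"
  proof
    fix s assume "s \<in> splits p"
    then obtain l r where "s = (l, r)" "p = l @ r" by (auto simp: splits_def)
    then show "s \<in> (\<lambda>i. (take i p, drop i p)) ` {..length p}"
      by (intro image_eqI[of _ _ "length l"]) auto
  qed
qed simp

lemma splits_Nil [simp]: "splits [] = {([], [])}"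
  by (auto simp: splits_def intro: dyckp.Nil)

lemma splits_arch:
  assumes "dyckp a" "dyckp b"
  shows "splits (True # a @ False # b) =
    insert ([], True # a @ False # b) ((\<lambda>(l, r). (True # a @ False # l, r)) ` splits b)"
proof (intro set_eqI iffI)
  fix s assume s: "s \<in> splits (True # a @ False # b)"
  obtain l r where lr: "s = (l, r)" "True # a @ False # b = l @ r" "dyckp l" "dyckp r"
    using s by (auto simp: splits_def)
  from lr(3) show "s \<in> insert ([], True # a @ False # b) ((\<lambda>(l, r). (True # a @ False # l, r)) ` splits b)"
  proof cases
    case (Cons a' b')
    then have "a = a' \<and> b = b' @ r"
      using dyckp_split_unique[of a a' b "b' @ r"] lr assms by simp
    then show ?thesis using lr Cons by (auto simp: splits_def intro!: image_eqI[of _ _ "(b', r)"])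
  qed (use lr in simp)
next
  fix s assume "s \<in> insert ([], True # a @ False # b) ((\<lambda>(l, r). (True # a @ False # l, r)) ` splits b)"
  then show "s \<in> splits (True # a @ False # b)"
    using assms dyckp.Cons[OF assms] by (auto simp: splits_def intro: dyckp.intros)
qed

definition split_sum :: "(bool list \<Rightarrow> bool list \<Rightarrow> 'a) \<Rightarrow> bool list \<Rightarrow> 'a::comm_ring_1" where
  "split_sum f p = (\<Sum>(l, r)\<in>splits p. f l r)"

lemma split_sum_Nil [simp]: "split_sum f [] = f [] []"
  by (simp add: split_sum_def)

lemma split_sum_arch:
  assumes "dyckp a" "dyckp b"
  shows "split_sum f (True # a @ False # b) =
    f [] (True # a @ False # b) + split_sum (\<lambda>l r. f (True # a @ False # l) r) b"
proof -
  have "split_sum f (True # a @ False # b) = f [] (True # a @ False # b) +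
      (\<Sum>(l, r)\<in>(\<lambda>(l, r). (True # a @ False # l, r)) ` splits b. f l r)"
    unfolding split_sum_def splits_arch[OF assms] by (subst sum.insert) auto
  also have "(\<Sum>(l, r)\<in>(\<lambda>(l, r). (True # a @ False # l, r)) ` splits b. f l r) =
      split_sum (\<lambda>l r. f (True # a @ False # l) r) b"
    unfolding split_sum_def by (subst sum.reindex) (auto simp: inj_on_def case_prod_unfold)
  finally show ?thesis .
qed

lemma split_sum_cong:
  "(\<And>l r. dyckp l \<Longrightarrow> dyckp r \<Longrightarrow> f l r = g l r) \<Longrightarrow> split_sum f p = split_sum g p"
  unfolding split_sum_def by (rule sum.cong) (auto simp: splits_def)

lemma split_sum_add: "split_sum (\<lambda>l r. f l r + g l r) p = split_sum f p + split_sum g p"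
  by (simp add: split_sum_def case_prod_unfold sum.distrib)

lemma split_sum_mult: "split_sum (\<lambda>l r. c * f l r) p = c * split_sum f p"
  by (simp add: split_sum_def case_prod_unfold sum_distrib_left)

text \<open>A geometric sum: there is one splitting per contact, and \<open>returns r\<close> takes
  each value from 0 to \<open>returns p\<close> once.\<close>

lemma split_sum_returns:
  "dyckp p \<Longrightarrow> (x - 1) * split_sum (\<lambda>l r. x ^ returns r) p = x ^ Suc (returns p) - 1"
proof (induction rule: dyckp.induct)
  case (Cons a b)
  then show ?case by (simp add: split_sum_arch returns_arch algebra_simps)
qed simp

text \<open>A point i lies in \<open>l\<close> exactly when the cut is at a contact weakly to its
  right. If there are k such contacts, \<open>returns r\<close> runs through 0, ..., k - 1 and the
  powers of y add up to (y^k - 1) / (y - 1).\<close>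

lemma split_sum_left_weight:
  "dyckp p \<Longrightarrow> (y - 1) * split_sum (\<lambda>l r. y ^ returns r * pointed_weight 1 1 w l) p =
     pointed_weight 1 y w p - pointed_weight 1 1 w p"
proof (induction rule: dyckp.induct)
  case (Cons a b)
  let ?H = "pointed_weight 1 1 w"
  have "split_sum (\<lambda>l r. y ^ returns r * ?H (True # a @ False # l)) b =
      split_sum (\<lambda>l r. (1 + w * ?H a) * y ^ returns r + y ^ returns r * ?H l) b"
    using Cons(1) by (intro split_sum_cong) (simp add: pointed_weight_arch algebra_simps)
  also have "\<dots> = (1 + w * ?H a) * split_sum (\<lambda>l r. y ^ returns r) b
      + split_sum (\<lambda>l r. y ^ returns r * ?H l) b"
    by (simp only: split_sum_add split_sum_mult)
  finally have "(y - 1) * split_sum (\<lambda>l r. y ^ returns r * ?H (True # a @ False # l)) b =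
      (1 + w * ?H a) * ((y - 1) * split_sum (\<lambda>l r. y ^ returns r) b)
      + (y - 1) * split_sum (\<lambda>l r. y ^ returns r * ?H l) b"
    by (simp add: algebra_simps)
  also have "\<dots> = (1 + w * ?H a) * (y ^ Suc (returns b) - 1) + (pointed_weight 1 y w b - ?H b)"
    by (simp only: split_sum_returns[OF Cons(2)] Cons.IH)
  finally show ?case
    using Cons by (simp add: split_sum_arch returns_arch pointed_weight_arch algebra_simps)
qed simp

text \<open>A point i lies in \<open>r\<close> exactly when the cut is weakly to its left. The c
  contacts before i, used as cuts, give the exponents 1, ..., c of x. A cut at i itself gives
  exponent 0 and requires i to be a contact; these cases add up to y + ... + y^(returns p + 1), the
  last summand.\<close>

lemma split_sum_right_weight:
  "dyckp p \<Longrightarrow> (x - 1) * (y - 1) * split_sum (\<lambda>l r. pointed_weight x y w r) p =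
     x * (y - 1) * (pointed_weight x y w p - pointed_weight 1 y w p)
     + (x - 1) * y * (y ^ Suc (returns p) - 1)"
proof (induction rule: dyckp.induct)
  case (Cons a b)
  have "(x - 1) * (y - 1) * split_sum (\<lambda>l r. pointed_weight x y w r) (True # a @ False # b) =
    (x - 1) * (y - 1) * pointed_weight x y w (True # a @ False # b) +
    (x - 1) * (y - 1) * split_sum (\<lambda>l r. pointed_weight x y w r) b"
    using Cons by (simp only: split_sum_arch distrib_left)
  then show ?case
    unfolding Cons.IH using Cons by (simp add: returns_arch pointed_weight_arch) (simp add: algebra_simps)
qed (simp add: algebra_simps)

section \<open>Generating functions of intervals\<close>

definition gf :: "(bool list \<Rightarrow> 'a) \<Rightarrow> 'a::comm_ring_1 fps" where
  "gf f = Abs_fps (\<lambda>n. \<Sum>(p, q)\<in>intervals n. f p)"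

text \<open>Coefficient n collects the pieces of the intervals of size n + 1; the first arch that is
  missing here becomes the factor \<open>fps_X\<close> in \<open>gf_rec\<close>.\<close>

definition gf_split :: "(bool list \<Rightarrow> bool list \<Rightarrow> bool list \<Rightarrow> 'a) \<Rightarrow> 'a::comm_ring_1 fps" where
  "gf_split f = Abs_fps (\<lambda>n. \<Sum>k\<le>n. \<Sum>(p1, q1)\<in>intervals k. \<Sum>(l, r)\<in>splits p1.
     \<Sum>(p2, q2)\<in>intervals (n - k). f l r p2)"

lemma intervals_0: "intervals 0 = {([], [])}"
proof -
  have "tle p q \<Longrightarrow> p = [] \<Longrightarrow> q = []" for p q using tle_length by fastforce
  then show ?thesis by (auto simp: intervals_eq intro: tle.Nil)
qed

lemma intervals_dyckp: "(p, q) \<in> intervals n \<Longrightarrow> dyckp p"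
  using tle_dyckp by (auto simp: intervals_eq)

definition join_intervals where
  "join_intervals = (\<lambda>(k :: nat, (p1 :: bool list, q1), (l, r), (p2 :: bool list, q2)).
     (True # l @ False # r @ p2, True # q1 @ False # q2))"

definition interval_pieces where
  "interval_pieces n = (SIGMA k:{..n}. SIGMA pq:intervals k. splits (fst pq) \<times> intervals (n - k))"

lemma join_intervals_image: "join_intervals ` interval_pieces n = intervals (Suc n)"
proof (intro set_eqI iffI)
  fix s assume "s \<in> join_intervals ` interval_pieces n"
  then obtain k p1 q1 l r p2 q2 where *: "s = (True # l @ False # r @ p2, True # q1 @ False # q2)"
    "k \<le> n" "(p1, q1) \<in> intervals k" "(l, r) \<in> splits p1" "(p2, q2) \<in> intervals (n - k)"
    by (auto simp: interval_pieces_def join_intervals_def)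
  then show "s \<in> intervals (Suc n)"
    using tle.Cons[of l r q1 p2 q2] by (auto simp: intervals_eq splits_def)
next
  fix s assume "s \<in> intervals (Suc n)"
  then obtain p q where s: "s = (p, q)" "tle p q" "length p = 2 * Suc n" by (auto simp: intervals_eq)
  from s(2) show "s \<in> join_intervals ` interval_pieces n"
  proof cases
    case (Cons l r q1 p2 q2)
    have "even (length (l @ r))" "even (length p2)"
      using tle_dyckp[OF Cons(5)] tle_dyckp[OF Cons(6)] by (auto dest!: dyckp_even)
    then obtain i j where ij: "length (l @ r) = 2 * i" "length p2 = 2 * j" by (meson evenE)
    then have "i + j = n" using s Cons by simp
    then have "(i, (l @ r, q1), (l, r), (p2, q2)) \<in> interval_pieces n"
      using Cons ij by (auto simp: interval_pieces_def splits_def intervals_eq)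
    then show ?thesis using s Cons
      by (intro image_eqI[of _ _ "(i, (l @ r, q1), (l, r), (p2, q2))"]) (auto simp: join_intervals_def)
  qed (use s in simp)
qed

text \<open>First-return decomposition recovers \<open>l\<close>, \<open>q1\<close>,
  \<open>q2\<close> and the concatenation \<open>r @ p2\<close>. The latter can be cut because
  \<open>p2\<close> is as long as \<open>q2\<close>.\<close>

lemma join_intervals_inj: "inj_on join_intervals (interval_pieces n)"
proof (rule inj_onI)
  fix s s' assume s: "s \<in> interval_pieces n" and s': "s' \<in> interval_pieces n"
    and eq: "join_intervals s = join_intervals s'"
  obtain k p1 q1 l r p2 q2 where 1: "s = (k, (p1, q1), (l, r), (p2, q2))" by (metis surj_pair)
  obtain k' p1' q1' l' r' p2' q2' where 2: "s' = (k', (p1', q1'), (l', r'), (p2', q2'))" by (metis surj_pair)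
  have h: "tle p1 q1" "length p1 = 2 * k" "p1 = l @ r" "dyckp l" "tle p2 q2"
    using s 1 by (auto simp: interval_pieces_def splits_def intervals_eq)
  have h': "tle p1' q1'" "length p1' = 2 * k'" "p1' = l' @ r'" "dyckp l'" "tle p2' q2'"
    using s' 2 by (auto simp: interval_pieces_def splits_def intervals_eq)
  from eq 1 2 have e: "l @ False # r @ p2 = l' @ False # r' @ p2'" "q1 @ False # q2 = q1' @ False # q2'"
    by (auto simp: join_intervals_def)
  have "q1 = q1'" "q2 = q2'" using dyckp_split_unique[OF _ _ e(2)] tle_dyckp h h' by blast+
  moreover have "l = l'" "r @ p2 = r' @ p2'" using dyckp_split_unique[OF _ _ e(1)] h h' by blast+
  moreover have "length p2 = length p2'" using tle_length h h' \<open>q2 = q2'\<close> by metis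
  ultimately show "s = s'" using h h' 1 2 by auto
qed

lemma sum_intervals_Suc:
  "(\<Sum>(p, q)\<in>intervals (Suc n). f p) = (\<Sum>k\<le>n. \<Sum>(p1, q1)\<in>intervals k. \<Sum>(l, r)\<in>splits p1.
     \<Sum>(p2, q2)\<in>intervals (n - k). f (True # l @ False # r @ p2) :: 'a::comm_ring_1)"
proof -
  have "(\<Sum>(p, q)\<in>intervals (Suc n). f p) = (\<Sum>s\<in>interval_pieces n. f (fst (join_intervals s)))"
    unfolding join_intervals_image[symmetric] sum.reindex[OF join_intervals_inj]
    by (simp add: case_prod_unfold)
  also have "\<dots> = (\<Sum>k\<le>n. \<Sum>pq\<in>intervals k. \<Sum>lr\<in>splits (fst pq). \<Sum>pq2\<in>intervals (n - k).
      f (fst (join_intervals (k, pq, lr, pq2))))"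
    unfolding interval_pieces_def by (simp add: sum.Sigma sum.cartesian_product case_prod_unfold)
  finally show ?thesis by (simp add: join_intervals_def case_prod_unfold)
qed

lemma gf_rec: "gf f = fps_const (f []) + fps_X * gf_split (\<lambda>l r p. f (True # l @ False # r @ p))"
proof (rule fps_ext)
  fix n show "gf f $ n = (fps_const (f []) + fps_X * gf_split (\<lambda>l r p. f (True # l @ False # r @ p))) $ n"
    by (cases n) (simp_all add: gf_def gf_split_def intervals_0 sum_intervals_Suc)
qed

lemma gf_split_cong:
  assumes "\<And>l r p. dyckp l \<Longrightarrow> dyckp r \<Longrightarrow> dyckp p \<Longrightarrow> f l r p = g l r p"
  shows "gf_split f = gf_split g"
  unfolding gf_split_def
  by (intro arg_cong[of _ _ Abs_fps] ext sum.cong refl)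
    (auto intro!: sum.cong assms simp: splits_def dest: intervals_dyckp)

lemma gf_cong:
  assumes "\<And>p. dyckp p \<Longrightarrow> f p = g p"
  shows "gf f = gf g"
  unfolding gf_def
  by (intro arg_cong[of _ _ Abs_fps] ext sum.cong refl) (auto intro: assms dest: intervals_dyckp)

lemma gf_add: "gf (\<lambda>p. f p + g p) = gf f + gf g"
  by (simp add: gf_def fps_eq_iff case_prod_unfold sum.distrib)

lemma gf_diff: "gf (\<lambda>p. f p - g p) = gf f - gf g"
  by (simp add: gf_def fps_eq_iff case_prod_unfold sum_subtractf)

lemma gf_mult: "gf (\<lambda>p. c * f p) = fps_const c * gf f"
  by (simp add: gf_def fps_eq_iff case_prod_unfold sum_distrib_left)

lemma gf_split_add: "gf_split (\<lambda>l r p. f l r p + g l r p) = gf_split f + gf_split g"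
  by (simp add: gf_split_def fps_eq_iff case_prod_unfold sum.distrib)

lemma gf_split_mult: "gf_split (\<lambda>l r p. c * f l r p) = fps_const c * gf_split f"
  by (simp add: gf_split_def fps_eq_iff case_prod_unfold sum_distrib_left)

lemma gf_split_product: "gf_split (\<lambda>l r p. f l r * g p) = gf (split_sum f) * gf g"
proof (rule fps_ext)
  fix n
  have "gf_split (\<lambda>l r p. f l r * g p) $ n = (\<Sum>k\<le>n. (\<Sum>(p1, q1)\<in>intervals k. split_sum f p1) *
      (\<Sum>(p2, q2)\<in>intervals (n - k). g p2))"
    unfolding gf_split_def split_sum_def
    by (simp only: case_prod_unfold sum_distrib_right) (simp only: sum_distrib_left fps_nth_Abs_fps)
  then show "gf_split (\<lambda>l r p. f l r * g p) $ n = (gf (split_sum f) * gf g) $ n"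
    by (simp add: gf_def fps_mult_nth atLeast0AtMost)
qed

section \<open>The series F and G and their functional equations\<close>

definition Fser :: "'a \<Rightarrow> 'a::comm_ring_1 fps" where
  "Fser x = gf (\<lambda>p. x ^ Suc (returns p))"

definition Gser :: "'a \<Rightarrow> 'a \<Rightarrow> 'a \<Rightarrow> 'a::comm_ring_1 fps" where
  "Gser x y w = gf (pointed_weight x y w)"

lemma gf_split_sum_returns:
  "fps_const (x - 1) * gf (split_sum (\<lambda>l r. x ^ returns r)) = Fser x - Fser 1"
proof -
  have "fps_const (x - 1) * gf (split_sum (\<lambda>l r. x ^ returns r))
      = gf (\<lambda>p. x ^ Suc (returns p) - 1 ^ Suc (returns p))"
    unfolding gf_mult[symmetric] by (intro gf_cong) (simp only: split_sum_returns power_one)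
  then show ?thesis by (simp only: gf_diff Fser_def)
qed

lemma gf_split_sum_left_weight:
  "fps_const (y - 1) * gf (split_sum (\<lambda>l r. y ^ returns r * pointed_weight 1 1 w l)) =
     Gser 1 y w - Gser 1 1 w"
proof -
  have "fps_const (y - 1) * gf (split_sum (\<lambda>l r. y ^ returns r * pointed_weight 1 1 w l))
      = gf (\<lambda>p. pointed_weight 1 y w p - pointed_weight 1 1 w p)"
    unfolding gf_mult[symmetric] by (intro gf_cong) (simp only: split_sum_left_weight)
  then show ?thesis by (simp only: gf_diff Gser_def)
qed

lemma gf_split_sum_right_weight:
  "fps_const ((x - 1) * (y - 1)) * gf (split_sum (\<lambda>l r. pointed_weight x y w r)) =
     fps_const (x * (y - 1)) * (Gser x y w - Gser 1 y w)
     + fps_const ((x - 1) * y) * (Fser y - Fser 1)"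
proof -
  have "fps_const ((x - 1) * (y - 1)) * gf (split_sum (\<lambda>l r. pointed_weight x y w r))
      = gf (\<lambda>p. x * (y - 1) * (pointed_weight x y w p - pointed_weight 1 y w p)
          + (x - 1) * y * (y ^ Suc (returns p) - 1 ^ Suc (returns p)))"
    unfolding gf_mult[symmetric] by (intro gf_cong) (simp only: split_sum_right_weight power_one)
  then show ?thesis by (simp only: gf_add gf_mult gf_diff Gser_def Fser_def)
qed

text \<open>The contacts of \<open>l\<close> disappear inside the first arch, so the weight only
  sees \<open>returns r\<close> and the contacts of \<open>p\<close>. The sum over the splittings
  then yields the divided difference of F at x and 1.\<close>

lemma Fser_equation:
  "(fps_const x - 1) * Fser x =
     fps_const x * (fps_const x - 1) + fps_X * fps_const x * Fser x * (Fser x - Fser 1)"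
proof -
  have "Fser x = fps_const x + fps_X *
      gf_split (\<lambda>l r p. x * (x ^ returns r * x ^ Suc (returns p)))"
    unfolding Fser_def
    by (subst gf_rec, intro arg_cong2[of _ _ _ _ "(+)"] arg_cong2[of _ _ _ _ "(*)"] gf_split_cong)
      (simp_all add: returns_arch returns_append power_add algebra_simps)
  then have F: "Fser x = fps_const x + fps_X * fps_const x * gf (split_sum (\<lambda>l r. x ^ returns r)) * Fser x"
    by (simp only: gf_split_mult gf_split_product Fser_def mult.assoc)
  have "(fps_const x - 1) * Fser x = (fps_const x - 1) * fps_const x +
      fps_X * fps_const x * ((fps_const x - 1) * gf (split_sum (\<lambda>l r. x ^ returns r))) * Fser x"
    by (subst F) (simp only: algebra_simps)
  also have "(fps_const x - 1) * gf (split_sum (\<lambda>l r. x ^ returns r)) = Fser x - Fser 1"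
    using gf_split_sum_returns[of x] by (simp add: fps_const_sub[symmetric] del: fps_const_sub)
  finally show ?thesis by (simp add: algebra_simps)
qed

lemma Gser_equation:
  fixes x y w :: "'a::comm_ring_1"
  defines "X \<equiv> fps_const x" and "Y \<equiv> fps_const y" and "V \<equiv> fps_const w" and "T \<equiv> fps_X"
  shows "Y * (X - 1) * (Y - 1) * Gser x y w =
    (X - 1) * (Y - 1) * Y * Fser y
    + T * V * X * Y * (X - 1) * Fser y * (Gser 1 y w - Gser 1 1 w)
    + T * X * X * (Y - 1) * Fser y * (Gser x y w - Gser 1 y w)
    + T * X * Y * (X - 1) * Fser y * (Fser y - Fser 1)
    + T * X * Y * (Y - 1) * (Fser x - Fser 1) * (Gser x y w - Fser y)"
proof -
  define R where "R z = gf (split_sum (\<lambda>l r. z ^ returns r))" for z :: 'a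
  define L where "L = gf (split_sum (\<lambda>l r. y ^ returns r * pointed_weight 1 1 w l))"
  define M where "M = gf (split_sum (\<lambda>l r. pointed_weight x y w r))"
  \<comment> \<open>When the marked point lies in \<open>r\<close>, the word after it contributes
    one contact less than in F(y), because the junction is already counted. The factor
    \<open>Y\<close> on the left-hand side compensates for this.\<close>
  define E where "E = gf (\<lambda>p. y ^ returns p)"
  have E: "Y * E = Fser y"
    unfolding Y_def E_def Fser_def gf_mult[symmetric] by simp
  \<comment> \<open>The four summands are the positions of the marked point: the origin, the first
    arch, \<open>r\<close>, and \<open>p\<close> without its starting point.\<close>
  have "gf_split (\<lambda>l r p. pointed_weight x y w (True # l @ False # r @ p)) =
     gf_split (\<lambda>l r p. y * (y ^ returns r * y ^ Suc (returns p))
       + w * x * ((y ^ returns r * pointed_weight 1 1 w l) * y ^ Suc (returns p))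
       + x * (pointed_weight x y w r * y ^ returns p)
       + x * (x ^ returns r * (pointed_weight x y w p - y ^ Suc (returns p))))"
    by (intro gf_split_cong)
      (simp add: pointed_weight_arch pointed_weight_append returns_append power_add algebra_simps)
  also have "\<dots> = Y * (R y * Fser y) + V * X * (L * Fser y) + X * (M * E)
      + X * (R x * (Gser x y w - Fser y))"
    by (simp only: gf_split_add gf_split_mult gf_split_product gf_diff R_def L_def M_def E_def
        Fser_def Gser_def X_def Y_def V_def fps_const_mult)
  finally have "Gser x y w = Y + T * (Y * (R y * Fser y) + V * X * (L * Fser y) + X * (M * E)
      + X * (R x * (Gser x y w - Fser y)))"
    unfolding Gser_def T_def Y_def using gf_rec[of "pointed_weight x y w"] by simp
  then have "Y * (X - 1) * (Y - 1) * Gser x y w = Y * (X - 1) * (Y - 1) *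
      (Y + T * (Y * (R y * Fser y) + V * X * (L * Fser y) + X * (M * E)
      + X * (R x * (Gser x y w - Fser y))))" by simp
  also have "\<dots> = Y * (X - 1) * (Y * (Y - 1) + T * Y * ((Y - 1) * R y) * Fser y)
      + T * V * X * Y * (X - 1) * Fser y * ((Y - 1) * L)
      + T * X * ((X - 1) * (Y - 1) * M) * (Y * E)
      + T * X * Y * (Y - 1) * ((X - 1) * R x) * (Gser x y w - Fser y)"
    by (simp only: algebra_simps)
  also have "(Y - 1) * R y = Fser y - Fser 1"
    using gf_split_sum_returns[of y] by (simp add: Y_def R_def fps_const_sub[symmetric] del: fps_const_sub)
  also have "(X - 1) * R x = Fser x - Fser 1"
    using gf_split_sum_returns[of x] by (simp add: X_def R_def fps_const_sub[symmetric] del: fps_const_sub)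
  also have "(Y - 1) * L = Gser 1 y w - Gser 1 1 w"
    using gf_split_sum_left_weight[of y w] by (simp add: Y_def L_def fps_const_sub[symmetric] del: fps_const_sub)
  also have "(X - 1) * (Y - 1) * M = X * (Y - 1) * (Gser x y w - Gser 1 y w) + (X - 1) * Y * (Fser y - Fser 1)"
    using gf_split_sum_right_weight[of x y w]
    by (simp add: X_def Y_def M_def fps_const_sub[symmetric] fps_const_mult[symmetric] del: fps_const_sub fps_const_mult)
  \<comment> \<open>These are the terms with the origin marked. All contacts then have weight y, so
    they must add up to F(y).\<close>
  also have "Y * (Y - 1) + T * Y * (Fser y - Fser 1) * Fser y = (Y - 1) * Fser y"
    using Fser_equation[of y]
    unfolding Y_def T_def by (simp only: algebra_simps)
  finally show ?thesis unfolding E by (simp add: algebra_simps)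
qed

section \<open>Fixed points and diagonals of power series\<close>

lemma fps_X_power_dvd_iff: "fps_X ^ n dvd (f :: 'a::comm_ring_1 fps) \<longleftrightarrow> (\<forall>k<n. f $ k = 0)"
proof
  assume "\<forall>k<n. f $ k = 0"
  then have "f = fps_X ^ n * Abs_fps (\<lambda>k. f $ (k + n))"
    by (auto simp: fps_eq_iff fps_X_power_mult_nth)
  then show "fps_X ^ n dvd f" by (rule dvdI)
qed (auto simp: fps_X_power_mult_nth elim!: dvdE)

lemma fps_X_dvd_iff: "fps_X dvd (f :: 'a::comm_ring_1 fps) \<longleftrightarrow> f $ 0 = 0"
  using fps_X_power_dvd_iff[of 1 f] by simp

lemma fps_eq_if_dvd_diff:
  assumes "\<And>n. fps_X ^ n dvd (f - g :: 'a::comm_ring_1 fps)"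
  shows "f = g"
proof (rule fps_ext)
  fix n show "f $ n = g $ n"
    using assms[of "Suc n"] by (simp add: fps_X_power_dvd_iff del: power_Suc)
qed

text \<open>Banach iteration for the t-adic distance: the hypothesis on \<open>H\<close> is a
  Lipschitz condition, and the zero constant coefficient of \<open>z\<close> turns it into a
  contraction.\<close>

lemma fps_fixpoint_exists:
  fixes z c :: "'a::comm_ring_1 fps"
  assumes z: "z $ 0 = 0" and H: "\<And>f g. f - g dvd H f - H g"
  shows "\<exists>f. f = c + z * H f"
proof -
  have zX: "fps_X dvd z" using z by (simp add: fps_X_dvd_iff)
  have contr: "fps_X ^ Suc n dvd (c + z * H f) - (c + z * H g)" if "fps_X ^ n dvd f - g" for n f g
  proof -
    have "fps_X ^ n dvd H f - H g" using that H dvd_trans by blast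
    then have "fps_X * fps_X ^ n dvd z * (H f - H g)" using zX by (rule mult_dvd_mono[rotated])
    then show ?thesis by (simp add: algebra_simps)
  qed
  define s where "s n = ((\<lambda>f. c + z * H f) ^^ n) 0" for n
  have s_Suc: "s (Suc n) = c + z * H (s n)" for n by (simp add: s_def)
  have step: "fps_X ^ n dvd s (Suc n) - s n" for n
  proof (induction n)
    case (Suc n)
    from contr[OF Suc] show ?case by (simp only: s_Suc)
  qed simp
  have far: "fps_X ^ n dvd s (n + m) - s n" for n m
  proof (induction m)
    case (Suc m)
    have "fps_X ^ n dvd s (Suc (n + m)) - s (n + m)"
      using step[of "n + m"] by (rule power_le_dvd) simp
    from dvd_add[OF this Suc] show ?case by simp
  qed simp
  \<comment> \<open>By \<open>far\<close>, coefficient n no longer changes from the iterate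
    \<open>s (Suc n)\<close> on.\<close>
  define f where "f = Abs_fps (\<lambda>n. s (Suc n) $ n)"
  have f: "fps_X ^ n dvd f - s n" for n
    unfolding fps_X_power_dvd_iff
  proof (intro allI impI)
    fix k assume "k < n"
    then obtain m where "n = Suc k + m" using less_iff_Suc_add[of k n] by auto
    then show "(f - s n) $ k = 0" using far[of "Suc k" m] by (simp add: fps_X_power_dvd_iff f_def del: power_Suc)
  qed
  have "f = c + z * H f"
  proof (rule fps_eq_if_dvd_diff)
    fix n
    have "fps_X ^ n dvd f - s (Suc n)" using f[of "Suc n"] by (rule power_le_dvd) simp
    moreover have "fps_X ^ n dvd (c + z * H f) - s (Suc n)"
      unfolding s_Suc using contr[OF f[of n]] by (rule power_le_dvd) simp
    ultimately show "fps_X ^ n dvd f - (c + z * H f)"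
      using dvd_diff[of "fps_X ^ n" "f - s (Suc n)" "(c + z * H f) - s (Suc n)"]
      by (simp add: diff_diff_eq2 add_diff_eq diff_add_eq)
  qed
  then show ?thesis by blast
qed

lemma fps_fixpoint_unique:
  fixes z c :: "'a::idom fps"
  assumes z: "z $ 0 = 0" and H: "\<And>f g. f - g dvd H f - H g"
    and f: "f = c + z * H f" and g: "g = c + z * H g"
  shows "f = g"
proof -
  obtain k where "H f - H g = (f - g) * k" using H[of f g] unfolding dvd_def by blast
  then have "(f - g) * (1 - z * k) = f - g - z * (H f - H g)"
    by (simp only: right_diff_distrib mult_1_right mult.left_commute)
  also have "\<dots> = 0" by (subst (1) f, subst (1) g) (simp add: algebra_simps)
  finally have "f - g = 0 \<or> 1 - z * k = 0" by (simp only: mult_eq_0_iff)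
  moreover have "(1 - z * k) $ 0 = 1" using z by simp
  then have "1 - z * k \<noteq> 0" by (metis fps_zero_nth zero_neq_one)
  ultimately show ?thesis by simp
qed

text \<open>Polynomial expressions H satisfy the hypothesis on H of the fixed point lemmas.\<close>

lemma diff_dvd_intros:
  fixes H K :: "'b::comm_ring_1 \<Rightarrow> 'b"
  shows "f - g dvd c - c" "f - g dvd f - g"
    and "f - g dvd H f - H g \<Longrightarrow> f - g dvd K f - K g \<Longrightarrow> f - g dvd (H f + K f) - (H g + K g)"
    and "f - g dvd H f - H g \<Longrightarrow> f - g dvd K f - K g \<Longrightarrow> f - g dvd (H f - K f) - (H g - K g)"
    and "f - g dvd H f - H g \<Longrightarrow> f - g dvd K f - K g \<Longrightarrow> f - g dvd (H f * K f) - (H g * K g)"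
proof -
  assume 1: "f - g dvd H f - H g" and 2: "f - g dvd K f - K g"
  show "f - g dvd (H f + K f) - (H g + K g)" using dvd_add[OF 1 2] by (simp add: algebra_simps)
  show "f - g dvd (H f - K f) - (H g - K g)" using dvd_diff[OF 1 2] by (simp add: algebra_simps)
  have "(H f * K f) - (H g * K g) = H f * (K f - K g) + (H f - H g) * K g"
    by (simp add: algebra_simps)
  with 1 2 show "f - g dvd (H f * K f) - (H g * K g)" by simp
qed simp_all

text \<open>The inverse is the fixed point of i = 1 + (1 - b) i, so no division of coefficients
  takes place.\<close>

lemma fps_unit_exists:
  fixes b :: "'a::comm_ring_1 fps"
  assumes "b $ 0 = 1"
  shows "\<exists>i. b * i = 1"
proof -
  have "\<exists>i. i = 1 + (1 - b) * i"
    using assms by (intro fps_fixpoint_exists[where H = "\<lambda>i. i"]) auto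
  then show ?thesis by (auto simp: algebra_simps)
qed

lemma fps_nonzero_if_const: "f $ 0 = 1 \<Longrightarrow> (f :: 'a::comm_ring_1 fps) \<noteq> 0"
  by auto

definition tree_param :: "'a::comm_ring_1 fps \<Rightarrow> bool" where
  "tree_param z \<longleftrightarrow> z $ 0 = 0 \<and> z * (1 - z) ^ 3 = fps_X"

lemma tree_param_exists: "\<exists>z :: 'a::comm_ring_1 fps. tree_param z"
proof -
  \<comment> \<open>With z = t q, the equation divided by t reads q (1 - t q)^3 = 1. This is its
    expansion, solved for the linear term.\<close>
  have "\<exists>q :: 'a fps. q = 1 + fps_X *
      (3 * (q * q) - 3 * fps_X * (q * q * q) + fps_X * fps_X * (q * q * q * q))"
    by (intro fps_fixpoint_exists diff_dvd_intros) simp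
  then obtain q :: "'a fps" where q: "q = 1 + fps_X *
      (3 * (q * q) - 3 * fps_X * (q * q * q) + fps_X * fps_X * (q * q * q * q))" ..
  have "fps_X * q * (1 - fps_X * q) ^ 3 = fps_X * (q - fps_X *
      (3 * (q * q) - 3 * fps_X * (q * q * q) + fps_X * fps_X * (q * q * q * q)))"
    by (simp add: algebra_simps power3_eq_cube)
  also have "\<dots> = fps_X" using q by (simp add: algebra_simps)
  finally have "tree_param (fps_X * q)" by (simp add: tree_param_def)
  then show ?thesis ..
qed

lemma tree_param_unique:
  assumes "tree_param (z :: 'a::idom fps)" "tree_param z'"
  shows "z = z'"
proof -
  \<comment> \<open>The divided difference of z (1 - z)^3.\<close>
  let ?k = "1 - 3 * (z + z') + 3 * (z * z + z * z' + z' * z') - (z + z') * (z * z + z' * z')"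
  have "(z - z') * ?k = z * (1 - z) ^ 3 - z' * (1 - z') ^ 3" by algebra
  also have "\<dots> = 0" using assms by (simp add: tree_param_def)
  finally have "z - z' = 0 \<or> ?k = 0" by (simp only: mult_eq_0_iff)
  moreover have "?k $ 0 = 1" using assms by (simp add: tree_param_def)
  ultimately show ?thesis using fps_nonzero_if_const[of ?k] by auto
qed

text \<open>Setting the outer variable of a double series equal to the inner one. A series in t whose
  coefficients are polynomials in x is evaluated at a series x = X(t) by viewing X as a constant of
  the coefficient ring of a double series and taking the diagonal.\<close>

definition diag :: "'a fps fps \<Rightarrow> 'a::comm_ring_1 fps" where
  "diag f = Abs_fps (\<lambda>n. \<Sum>k\<le>n. (f $ k) $ (n - k))"

lemma diag_const [simp]: "diag (fps_const c) = c"
proof (rule fps_ext)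
  fix n
  have "(\<Sum>k\<le>n. (fps_const c $ k) $ (n - k)) = (\<Sum>k\<in>{0}. (fps_const c $ k) $ (n - k))"
    by (rule sum.mono_neutral_right) auto
  then show "diag (fps_const c) $ n = c $ n" by (simp add: diag_def)
qed

lemma diag_add [simp]: "diag (f + g) = diag f + diag g"
  by (simp add: diag_def fps_eq_iff sum.distrib)

lemma diag_X_mult: "diag (fps_X * f) = fps_X * diag f"
proof (rule fps_ext)
  fix n show "diag (fps_X * f) $ n = (fps_X * diag f) $ n"
    by (cases n) (simp_all add: diag_def sum.atMost_Suc_shift del: sum.atMost_Suc)
qed

lemma diag_rec: "diag f = f $ 0 + fps_X * diag (fps_shift 1 f)"
proof -
  have "f = fps_const (f $ 0) + fps_X * fps_shift 1 f"
    by (simp add: fps_eq_iff)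
  then have "diag f = diag (fps_const (f $ 0) + fps_X * fps_shift 1 f)" by simp
  then show ?thesis by (simp add: diag_X_mult)
qed

text \<open>Peeling off the constant terms in the outer variable reduces coefficient n to
  coefficient n - 1 of simpler products, which avoids rearranging a fourfold sum.\<close>

lemma diag_mult [simp]: "diag (f * g) = diag f * diag g"
proof (rule fps_ext)
  fix n show "diag (f * g) $ n = (diag f * diag g) $ n"
  proof (induction n arbitrary: f g rule: less_induct)
    case (less n)
    define f' g' where "f' = fps_shift 1 f" and "g' = fps_shift 1 g"
    have f: "f = fps_const (f $ 0) + fps_X * f'" and g: "g = fps_const (g $ 0) + fps_X * g'"
      by (simp_all add: fps_eq_iff f'_def g'_def)
    have "f * g = fps_const (f $ 0) * g + fps_X * (f' * g)"
      using arg_cong[OF f, of "\<lambda>h. h * g"] by (simp only: distrib_right mult.assoc)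
    also have "fps_const (f $ 0) * g = fps_const (f $ 0 * g $ 0) + fps_X * (fps_const (f $ 0) * g')"
      using arg_cong[OF g, of "\<lambda>h. fps_const (f $ 0) * h"]
      by (simp only: distrib_left mult.left_commute fps_const_mult)
    finally have "f * g = fps_const (f $ 0 * g $ 0) + fps_X * (fps_const (f $ 0) * g' + f' * g)"
      by (simp only: distrib_left add.assoc)
    then have 1: "diag (f * g) = f $ 0 * g $ 0 + fps_X * (diag (fps_const (f $ 0) * g') + diag (f' * g))"
      by (simp add: diag_X_mult)
    have 2: "diag f * diag g = f $ 0 * g $ 0 + fps_X * (f $ 0 * diag g' + diag f' * diag g)"
      using diag_rec[of f] diag_rec[of g] unfolding f'_def[symmetric] g'_def[symmetric]
      by (simp add: algebra_simps)
    show ?case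
    proof (cases n)
      case (Suc m)
      then have "diag (fps_const (f $ 0) * g') $ m = (diag (fps_const (f $ 0)) * diag g') $ m"
        "diag (f' * g) $ m = (diag f' * diag g) $ m" using less[of m] by blast+
      then show ?thesis unfolding 1 2 using Suc by simp
    qed (unfold 1 2, simp)
  qed
qed

lemma diag_1 [simp]: "diag 1 = 1"
  using diag_const[of 1] by simp

lemma diag_X [simp]: "diag fps_X = fps_X"
  using diag_X_mult[of 1] by simp

lemma diag_diff [simp]: "diag (f - g) = diag f - diag g"
  by (simp add: diag_def fps_eq_iff sum_subtractf)

lemma diag_coeffwise_const: "diag (Abs_fps (\<lambda>n. fps_const (c n))) = Abs_fps c"
proof (rule fps_ext)
  fix n
  have "(\<Sum>k\<le>n. fps_const (c k) $ (n - k)) = (\<Sum>k\<in>{n}. fps_const (c k) $ (n - k))"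
    by (rule sum.mono_neutral_right) auto
  then show "diag (Abs_fps (\<lambda>n. fps_const (c n))) $ n = Abs_fps c $ n" by (simp add: diag_def)
qed

section \<open>Evaluation of series with polynomial coefficients\<close>

definition poly_coeffs :: "'a \<Rightarrow> 'a poly fps \<Rightarrow> 'a::comm_ring_1 fps" where
  "poly_coeffs x f = Abs_fps (\<lambda>n. poly (f $ n) x)"

lemma poly_coeffs_add [simp]: "poly_coeffs x (f + g) = poly_coeffs x f + poly_coeffs x g"
  and poly_coeffs_diff [simp]: "poly_coeffs x (f - g) = poly_coeffs x f - poly_coeffs x g"
  and poly_coeffs_mult [simp]: "poly_coeffs x (f * g) = poly_coeffs x f * poly_coeffs x g"
  and poly_coeffs_const [simp]: "poly_coeffs x (fps_const p) = fps_const (poly p x)"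
  and poly_coeffs_X [simp]: "poly_coeffs x fps_X = fps_X"
  and poly_coeffs_1 [simp]: "poly_coeffs x 1 = 1"
  by (auto simp: poly_coeffs_def fps_eq_iff fps_mult_nth poly_sum fps_X_def)

lemma poly_coeffs_gf: "poly_coeffs x (gf f) = gf (\<lambda>p. poly (f p) x)"
  by (simp add: poly_coeffs_def gf_def fps_eq_iff poly_sum case_prod_unfold)

lemma poly_coeffs_Fser: "poly_coeffs x (Fser p) = Fser (poly p x)"
  by (simp add: Fser_def poly_coeffs_gf)

lemma poly_coeffs_tree_param: "tree_param z \<Longrightarrow> tree_param (poly_coeffs x z)"
proof -
  assume "tree_param z"
  then have "(poly_coeffs x z) $ 0 = 0" "poly_coeffs x (z * (1 - z) ^ 3) = poly_coeffs x fps_X"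
    by (simp_all add: tree_param_def poly_coeffs_def)
  then show ?thesis by (simp add: tree_param_def power3_eq_cube)
qed

lemma diag_tree_param: "tree_param z \<Longrightarrow> (z $ 0) $ 0 = 0 \<Longrightarrow> tree_param (diag z)"
proof -
  assume "tree_param z"
  then have "diag (z * (1 - z) ^ 3) = diag fps_X" "(diag z) $ 0 = 0"
    by (simp_all add: tree_param_def diag_def)
  then show ?thesis by (simp add: tree_param_def power3_eq_cube)
qed

section \<open>Parametrization of the series counting intervals by contacts\<close>

text \<open>The map from f(x) to f(1), with values in the same ring so that F(x) - F(1) makes sense
  there.\<close>

definition const_at_1 :: "'a poly fps \<Rightarrow> 'a::comm_ring_1 poly fps" where
  "const_at_1 f = Abs_fps (\<lambda>n. [:poly (f $ n) 1:])"

lemma const_poly_sum: "[:\<Sum>i\<in>A. h i:] = (\<Sum>i\<in>A. [:h i:])"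
proof (induction A rule: infinite_finite_induct)
  case (insert a A)
  have "[:h a + sum h A:] = [:h a:] + [:sum h A:]" by simp
  with insert show ?case by simp
qed auto

lemma const_at_1_simps [simp]:
  fixes f g :: "'a::comm_ring_1 poly fps"
  shows "const_at_1 (f + g) = const_at_1 f + const_at_1 g"
    and "const_at_1 (f - g) = const_at_1 f - const_at_1 g"
    and "const_at_1 (f * g) = const_at_1 f * const_at_1 g"
    and "const_at_1 (fps_const p) = fps_const [:poly p (1 :: 'a):]"
    and "const_at_1 (fps_X :: 'a poly fps) = fps_X"
    and "const_at_1 (1 :: 'a poly fps) = 1"
  by (auto simp: const_at_1_def fps_eq_iff fps_X_def one_pCons fps_mult_nth poly_sum const_poly_sum mult.commute)

lemma const_at_1_2 [simp]: "const_at_1 (2 :: 'a::comm_ring_1 poly fps) = 2"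
proof -
  have "const_at_1 (1 + 1 :: 'a poly fps) = 1 + 1" by (simp only: const_at_1_simps)
  then show ?thesis by simp
qed

lemma const_at_1_Fser: "const_at_1 (Fser [:0, 1:]) = Fser (1 :: 'a::comm_ring_1 poly)"
  by (auto simp: const_at_1_def Fser_def gf_def fps_eq_iff poly_sum
      case_prod_unfold of_nat_poly)

lemma const_at_1_dvd: "fps_X ^ n dvd f \<Longrightarrow> fps_X ^ n dvd const_at_1 f"
  by (simp add: fps_X_power_dvd_iff const_at_1_def)

text \<open>Coefficient n of (x - 1) F is determined by the smaller coefficients of F, and x - 1 can
  be cancelled because x is an indeterminate. For this reason the guess is verified over polynomials
  and specialized afterwards.\<close>

lemma Fser_equation_unique:
  fixes F F' :: "'a::idom poly fps"
  defines "x \<equiv> fps_const [:0, 1:]"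
  assumes F: "(x - 1) * F = x * (x - 1) + fps_X * x * F * (F - const_at_1 F)"
    and F': "(x - 1) * F' = x * (x - 1) + fps_X * x * F' * (F' - const_at_1 F')"
  shows "F = F'"
proof (rule fps_eq_if_dvd_diff)
  fix n
  define D where "D = F - F'"
  have eq: "(x - 1) * D = fps_X * x * (D * (F - const_at_1 F) + F' * (D - const_at_1 D))"
  proof -
    have "(x - 1) * D = (x - 1) * F - (x - 1) * F'" by (simp add: D_def algebra_simps)
    then show ?thesis unfolding F F' by (simp add: D_def algebra_simps)
  qed
  show "fps_X ^ n dvd F - F'"
    unfolding D_def[symmetric]
  proof (induction n)
    case (Suc n)
    have "fps_X ^ n dvd D * (F - const_at_1 F) + F' * (D - const_at_1 D)"
      using Suc const_at_1_dvd[OF Suc] by (intro dvd_add dvd_mult dvd_mult2 dvd_diff)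
    then have "fps_X ^ Suc n dvd (x - 1) * D"
      unfolding eq by (simp add: mult.assoc mult_dvd_mono)
    then have "((x - 1) * D) $ n = 0" by (simp add: fps_X_power_dvd_iff del: power_Suc)
    moreover have "x - 1 = fps_const ([:0, 1:] - 1)" by (simp add: x_def)
    then have "((x - 1) * D) $ n = ([:0, 1:] - 1) * D $ n" by simp
    moreover have "[:0, 1:] - 1 \<noteq> (0 :: 'a poly)" by (simp add: one_pCons)
    ultimately have "D $ n = 0" by (metis mult_eq_0_iff)
    then show ?case using Suc by (auto simp: fps_X_power_dvd_iff less_Suc_eq simp del: power_Suc)
  qed simp
qed

lemma Fser_param_poly:
  fixes z u :: "'a::idom poly fps"
  assumes z: "tree_param z" and u: "fps_const [:0, 1:] * (1 + z * u) ^ 2 = 1 + u"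
  shows "Fser [:0, 1:] * ((1 + z * u) * (1 - z) ^ 3) = (1 + u) * (1 - 2 * z - z ^ 2 * u)"
proof -
  define x :: "'a poly fps" where "x = fps_const [:0, 1:]"
  define s where "s = 1 + z * u"
  define P where "P = 1 - 2 * z - z ^ 2 * u"
  have z0: "z $ 0 = 0" and zX: "z * (1 - z) ^ 3 = fps_X" using z by (auto simp: tree_param_def)
  have s0: "s $ 0 = 1" and b0: "((1 - z) ^ 3) $ 0 = 1" using z0 by (simp_all add: s_def power3_eq_cube)
  obtain i j where i: "s * i = 1" and j: "(1 - z) ^ 3 * j = 1"
    using fps_unit_exists s0 b0 by meson
  have snz: "s \<noteq> 0" and bnz: "(1 - z) ^ 3 \<noteq> 0" using s0 b0 fps_nonzero_if_const by auto
  have xs: "x * s ^ 2 = 1 + u" using u by (simp add: x_def s_def)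
  \<comment> \<open>the guessed values of \<open>Fser x\<close> and \<open>Fser 1\<close>; the latter is the former at u = 0, that is, x = 1\<close>
  define F' where "F' = (1 + u) * P * i * j"
  define F1 where "F1 = (1 - 2 * z) * j"
  define b where "b = (1 - z) ^ 3"
  have "F' * s * b = (1 + u) * P * (s * i) * (b * j)" by (simp add: F'_def mult_ac)
  then have F': "F' * s * b = (1 + u) * P" using i j by (simp add: b_def)
  have F1: "F1 * b = 1 - 2 * z" using j by (simp add: F1_def b_def mult_ac)
  have cz: "const_at_1 z = z"
  proof (rule tree_param_unique[OF _ z])
    have "const_at_1 (z * (1 - z) ^ 3) = const_at_1 fps_X" using zX by simp
    then show "tree_param (const_at_1 z)" using z0
      by (simp add: tree_param_def power3_eq_cube) (simp add: const_at_1_def)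
  qed
  \<comment> \<open>At x = 1 the defining equation of u becomes u = z (2 u + z u^2), whose only
    solution is 0.\<close>
  have cu: "const_at_1 u = 0"
  proof (rule fps_fixpoint_unique[OF z0, where c = 0 and H = "\<lambda>u. 2 * u + z * u * u"])
    show "f - g dvd 2 * f + z * f * f - (2 * g + z * g * g)" for f g :: "'a poly fps"
      by (intro diff_dvd_intros)
    have "const_at_1 (x * (1 + z * u) ^ 2) = const_at_1 (1 + u)" using xs by (simp add: s_def)
    then have "(1 + z * const_at_1 u) ^ 2 = 1 + const_at_1 u"
      by (simp add: x_def power2_eq_square cz flip: one_pCons)
    then show "const_at_1 u = 0 + z * (2 * const_at_1 u + z * const_at_1 u * const_at_1 u)"
      by (simp add: power2_eq_square algebra_simps)
  qed simp
  have cF': "const_at_1 F' = F1"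
  proof -
    have "const_at_1 (F' * s * ((1 - z) * (1 - z) * (1 - z))) = const_at_1 ((1 + u) * P)"
      using F' by (simp add: b_def power3_eq_cube mult.assoc)
    then have "const_at_1 F' * (1 - z) ^ 3 = F1 * b"
      unfolding F1 by (simp add: s_def P_def cz cu power2_eq_square power3_eq_cube mult.assoc)
    then show ?thesis using bnz by (simp add: b_def)
  qed
  have xu: "(x - 1) * s ^ 2 = u * P"
    using xs unfolding s_def P_def by algebra
  \<comment> \<open>The factor \<open>s ^ 4 * b\<close> clears the denominators of x, of
    \<open>F'\<close> and of \<open>F1\<close> in the functional equation, where t stands for
    \<open>z * b\<close>. What remains is a polynomial identity in z and u.\<close>
  have "((x - 1) * F') * (s ^ 4 * b) = ((x - 1) * s ^ 2) * s * (F' * s * b)"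
    by (simp add: power_numeral_reduce mult_ac)
  also have "\<dots> = (u * P) * s * ((1 + u) * P)" by (simp only: xu F')
  also have "\<dots> = (1 + u) * (u * P) * b + z * (1 + u) * ((1 + u) * P) * ((1 + u) * P - (1 - 2 * z) * s)"
    unfolding s_def P_def b_def by algebra
  also have "(1 + u) * (u * P) * b = (x * s ^ 2) * ((x - 1) * s ^ 2) * b" by (simp only: xu xs)
  also have "z * (1 + u) * ((1 + u) * P) * ((1 + u) * P - (1 - 2 * z) * s) =
      z * (x * s ^ 2) * (F' * s * b) * (F' * s * b - (F1 * b) * s)"
    by (simp only: xs F' F1)
  also have "(x * s ^ 2) * ((x - 1) * s ^ 2) * b + z * (x * s ^ 2) * (F' * s * b) * (F' * s * b - (F1 * b) * s) =
      (x * (x - 1) + (z * b) * x * F' * (F' - F1)) * (s ^ 4 * b)"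
    by algebra
  finally have "(x - 1) * F' = x * (x - 1) + fps_X * x * F' * (F' - const_at_1 F')"
    using snz bnz cF' zX by (simp add: b_def)
  moreover have "(x - 1) * Fser [:0, 1:] = x * (x - 1) +
      fps_X * x * Fser [:0, 1:] * (Fser [:0, 1:] - const_at_1 (Fser [:0, 1:]))"
    using Fser_equation[of "[:0, 1:] :: 'a poly"] by (simp only: x_def const_at_1_Fser)
  ultimately have "Fser [:0, 1:] = F'"
    using Fser_equation_unique[of "Fser [:0, 1:]" F'] by (simp only: x_def)
  then show ?thesis using F' by (simp add: s_def P_def b_def mult.assoc)
qed

definition Fhat :: "'a::comm_ring_1 fps \<Rightarrow> 'a fps" where
  "Fhat x = diag (Fser x)"

text \<open>The generic identity is transported by the ring homomorphism \<open>ev\<close>, which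
  sends the indeterminate to the series x. Uniqueness of fixed points identifies the images of the
  generic \<open>z'\<close> and \<open>v\<close> with the given z and u.\<close>

lemma Fhat_param:
  fixes z u x :: "'a::idom fps"
  assumes z: "tree_param z" and u: "x * (1 + z * u) ^ 2 = 1 + u"
  shows "Fhat x * ((1 + z * u) * (1 - z) ^ 3) = (1 + u) * (1 - 2 * z - z ^ 2 * u)"
proof -
  define ev where "ev f = diag (poly_coeffs x f)" for f
  have ev: "ev (f + g) = ev f + ev g" "ev (f - g) = ev f - ev g" "ev (f * g) = ev f * ev g"
    "ev 1 = 1" "ev (fps_const [:0, 1:]) = x" "ev (Fser [:0, 1:]) = Fhat x" for f g
    by (simp_all add: ev_def poly_coeffs_Fser Fhat_def)
  obtain z' :: "'a fps poly fps" where z': "tree_param z'" using tree_param_exists ..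
  have "\<exists>v. v = fps_const [:-1, 1:] + z' * (fps_const [:0, 1:] * (v + v) + fps_const [:0, 1:] * z' * v * v)"
    using z' by (intro fps_fixpoint_exists diff_dvd_intros) (simp add: tree_param_def)
  then obtain v where v: "v = fps_const [:-1, 1:] + z' *
      (fps_const [:0, 1:] * (v + v) + fps_const [:0, 1:] * z' * v * v)" ..
  have "fps_const [:-1, 1:] = fps_const [:0, 1:] - (1 :: 'a fps poly fps)"
    by (simp add: fps_eq_iff one_pCons)
  with v have v': "fps_const [:0, 1:] * (1 + z' * v) ^ 2 = 1 + v" by algebra
  have "ev z' = z"
  proof (rule tree_param_unique[OF _ z])
    show "tree_param (ev z')" unfolding ev_def
      using z' by (intro diag_tree_param poly_coeffs_tree_param) (auto simp: tree_param_def poly_coeffs_def)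
  qed
  have "ev (fps_const [:0, 1:] * ((1 + z' * v) * (1 + z' * v))) = ev (1 + v)"
    using v' by (simp add: power2_eq_square)
  then have ev_v: "x * ((1 + z * ev v) * (1 + z * ev v)) = 1 + ev v" by (simp only: ev \<open>ev z' = z\<close>)
  have "ev v = u"
  proof (rule fps_fixpoint_unique[where z = z and c = "x - 1" and H = "\<lambda>u. x * (u + u) + x * z * u * u"])
    show "z $ 0 = 0" using z by (simp add: tree_param_def)
    show "f - g dvd x * (f + f) + x * z * f * f - (x * (g + g) + x * z * g * g)" for f g
      by (intro diff_dvd_intros)
    show "ev v = x - 1 + z * (x * (ev v + ev v) + x * z * ev v * ev v)" using ev_v by algebra
    show "u = x - 1 + z * (x * (u + u) + x * z * u * u)" using u by algebra
  qed
  have "ev (Fser [:0, 1:] * ((1 + z' * v) * ((1 - z') * (1 - z') * (1 - z')))) =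
      ev ((1 + v) * (1 - (1 + 1) * z' - z' * z' * v))"
    using Fser_param_poly[OF z' v'] by (simp add: power2_eq_square power3_eq_cube)
  then show ?thesis
    by (simp only: ev \<open>ev z' = z\<close> \<open>ev v = u\<close>) (simp add: power2_eq_square power3_eq_cube mult.assoc)
qed

section \<open>The kernel method\<close>

definition Ghat :: "'a::comm_ring_1 fps \<Rightarrow> 'a fps \<Rightarrow> 'a fps \<Rightarrow> 'a fps" where
  "Ghat x y w = diag (Gser x y w)"

lemma fps_const_sum: "fps_const (sum f A) = (\<Sum>i\<in>A. fps_const (f i))"
  by (induction A rule: infinite_finite_induct) (auto simp flip: fps_const_add)

lemma diag_gf_const: "diag (gf (\<lambda>p. fps_const (f p))) = gf f"
  using diag_coeffwise_const[of "\<lambda>n. \<Sum>(p, q)\<in>intervals n. f p"]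
  by (simp add: gf_def fps_const_sum case_prod_unfold)

lemma Fhat_const: "Fhat (fps_const x) = Fser x"
proof -
  have "(\<lambda>p. fps_const x ^ Suc (returns p)) = (\<lambda>p. fps_const (x ^ Suc (returns p)))"
    by (simp only: fps_const_power)
  then show ?thesis unfolding Fhat_def Fser_def by (simp only: diag_gf_const)
qed

lemma Ghat_const: "Ghat (fps_const x) (fps_const y) (fps_const w) = Gser x y w"
proof -
  have "pointed_weight (fps_const x) (fps_const y) (fps_const w) = (\<lambda>p. fps_const (pointed_weight x y w p))"
    by (simp add: pointed_weight_def fps_const_sum fun_eq_iff)
  then show ?thesis unfolding Ghat_def Gser_def by (simp only: diag_gf_const)
qed

lemma Fhat_equation:
  "(x - 1) * Fhat x = x * (x - 1) + fps_X * x * Fhat x * (Fhat x - Fhat 1)"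
proof -
  have "diag ((fps_const x - 1) * Fser x) =
      diag (fps_const x * (fps_const x - 1) + fps_X * fps_const x * Fser x * (Fser x - Fser 1))"
    by (simp only: Fser_equation)
  then show ?thesis by (simp add: Fhat_def)
qed

lemma Ghat_equation:
  "y * (x - 1) * (y - 1) * Ghat x y w =
    (x - 1) * (y - 1) * y * Fhat y
    + fps_X * w * x * y * (x - 1) * Fhat y * (Ghat 1 y w - Ghat 1 1 w)
    + fps_X * x * x * (y - 1) * Fhat y * (Ghat x y w - Ghat 1 y w)
    + fps_X * x * y * (x - 1) * Fhat y * (Fhat y - Fhat 1)
    + fps_X * x * y * (y - 1) * (Fhat x - Fhat 1) * (Ghat x y w - Fhat y)"
  using arg_cong[OF Gser_equation[of y x w], of diag] by (simp add: Fhat_def Ghat_def)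


text \<open>The relation x = (1 + u) / (1 + z u)^2; the value u = 0 belongs to x = 1.\<close>

definition is_param :: "'a::comm_ring_1 fps \<Rightarrow> 'a fps \<Rightarrow> 'a fps \<Rightarrow> bool" where
  "is_param z x u \<longleftrightarrow> tree_param z \<and> x * (1 + z * u) ^ 2 = 1 + u"

lemma is_param_facts:
  fixes z x u :: "'a::idom fps"
  assumes "is_param z x u"
  shows "(x - 1) * (1 + z * u) ^ 2 = u * (1 - 2 * z - z ^ 2 * u)"
    and "Fhat x * (1 + z * u) * (1 - z) ^ 3 = (1 + u) * (1 - 2 * z - z ^ 2 * u)"
    and "1 + z * u \<noteq> 0" "1 - 2 * z - z ^ 2 * u \<noteq> 0"
    and "1 + u \<noteq> 0 \<Longrightarrow> x \<noteq> 0" and "1 + u \<noteq> 0 \<Longrightarrow> Fhat x \<noteq> 0" and "u \<noteq> 0 \<Longrightarrow> x \<noteq> 1"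
proof -
  have z: "tree_param z" and u: "x * (1 + z * u) ^ 2 = 1 + u" using assms by (auto simp: is_param_def)
  have z0: "z $ 0 = 0" using z by (simp add: tree_param_def)
  show 1: "(x - 1) * (1 + z * u) ^ 2 = u * (1 - 2 * z - z ^ 2 * u)" using u by algebra
  show 2: "Fhat x * (1 + z * u) * (1 - z) ^ 3 = (1 + u) * (1 - 2 * z - z ^ 2 * u)"
    using Fhat_param[OF z u] by (simp add: mult.assoc)
  show 3: "1 + z * u \<noteq> 0" using z0 by (intro fps_nonzero_if_const) simp
  show 4: "1 - 2 * z - z ^ 2 * u \<noteq> 0" using z0 by (intro fps_nonzero_if_const) (simp add: power2_eq_square)
  show "1 + u \<noteq> 0 \<Longrightarrow> x \<noteq> 0" using u by auto
  show "1 + u \<noteq> 0 \<Longrightarrow> Fhat x \<noteq> 0" using 2 4 by auto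
  show "u \<noteq> 0 \<Longrightarrow> x \<noteq> 1" using 1 4 by auto
qed

text \<open>\<open>kernel_u\<close> is the vanishing of the coefficient of \<open>Ghat x y w\<close> in its functional equation,
  written in the parameters of x and y.\<close>

locale kernel =
  fixes z w x y u v :: "'a::idom fps"
  assumes xu: "is_param z x u" and yv: "is_param z y v"
    and u0: "u $ 0 = 0" and v_nz: "v \<noteq> 0" and v1_nz: "1 + v \<noteq> 0"
    and kernel_u: "(1 - z) ^ 2 * u = z * (1 + u) * (1 + z * v)"
begin

lemma z: "z $ 0 = 0" "z * (1 - z) ^ 3 = fps_X"
  using xu by (auto simp: is_param_def tree_param_def)

lemma z_nz: "z \<noteq> 0" "1 - z \<noteq> 0"
  using z by auto

lemma u_nz: "u \<noteq> 0" "1 + u \<noteq> 0"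
proof -
  show "1 + u \<noteq> 0" using u0 by (intro fps_nonzero_if_const) simp
  show "u \<noteq> 0" using kernel_u is_param_facts(3)[OF yv] z_nz by auto
qed

lemma nonzero: "x \<noteq> 0" "Fhat x \<noteq> 0" "x - 1 \<noteq> 0" "y \<noteq> 0" "Fhat y \<noteq> 0" "y - 1 \<noteq> 0"
  using is_param_facts[OF xu] is_param_facts[OF yv] u_nz v_nz v1_nz by auto

text \<open>The kernel in product form: multiplying \<open>kernel_G\<close> by F(x) and inserting
  the equation of F(x) gives this relation up to the factor x. Here every factor is explicit in the
  parameters.\<close>

lemma kernel_F: "y * (x - 1) = fps_X * x * Fhat x * Fhat y"
proof -
  let ?s = "1 + z * u" and ?r = "1 + z * v" and ?b = "(1 - z) ^ 3"
  let ?P = "1 - 2 * z - z ^ 2 * u" and ?Q = "1 - 2 * z - z ^ 2 * v"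
  have x: "x * ?s ^ 2 = 1 + u" and y: "y * ?r ^ 2 = 1 + v" using xu yv by (auto simp: is_param_def)
  \<comment> \<open>An equivalent form of \<open>kernel_u\<close>; the product of both forms is
    \<open>key\<close>.\<close>
  have "(1 + u) * ?Q = (1 - z) * ?s" using kernel_u by algebra
  then have key: "u * ?s * ?b = z * (1 + u) ^ 2 * ?Q * ?r" using kernel_u by algebra
  have "y * (x - 1) * (?s ^ 3 * ?r ^ 2 * ?b) = (y * ?r ^ 2) * ((x - 1) * ?s ^ 2) * (?s * ?b)"
    by (simp add: power2_eq_square power3_eq_cube mult_ac)
  also have "\<dots> = (1 + v) * ?P * (u * ?s * ?b)" unfolding y is_param_facts(1)[OF xu] by (simp add: mult_ac)
  also have "\<dots> = z * (1 + u) * ((1 + u) * ?P) * ((1 + v) * ?Q) * ?r"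
    unfolding key by (simp add: power2_eq_square mult_ac)
  also have "\<dots> = z * (x * ?s ^ 2) * (Fhat x * ?s * ?b) * (Fhat y * ?r * ?b) * ?r"
    by (simp only: x is_param_facts(2)[OF xu] is_param_facts(2)[OF yv])
  also have "\<dots> = ((z * ?b) * x * Fhat x * Fhat y) * (?s ^ 3 * ?r ^ 2 * ?b)"
    by (simp add: power2_eq_square power3_eq_cube mult_ac)
  finally show ?thesis
    using is_param_facts(3)[OF xu] is_param_facts(3)[OF yv] z_nz by (simp add: z)
qed

lemma kernel_G: "y * (x - 1) = fps_X * x * x * Fhat y + fps_X * x * y * (Fhat x - Fhat 1)"
proof -
  have "y * (x - 1) * Fhat x = (fps_X * x * x * Fhat y + fps_X * x * y * (Fhat x - Fhat 1)) * Fhat x"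
    using kernel_F Fhat_equation[of x] by algebra
  then show ?thesis using nonzero by simp
qed

text \<open>Once G(x,y) has dropped out, everything that remains is divisible by F(y).\<close>

lemma kernel_equation:
  "(x - 1) * (y - 1) * y + fps_X * x * (w * y * (x - 1) - x * (y - 1)) * Ghat 1 y w
   - fps_X * w * x * y * (x - 1) * Ghat 1 1 w
   + fps_X * x * y * (x - 1) * (Fhat y - Fhat 1) - fps_X * x * y * (y - 1) * (Fhat x - Fhat 1) = 0"
  (is "?E = 0")
proof -
  have "?E * Fhat y = 0" using Ghat_equation[of y x w] kernel_G by algebra
  then show ?thesis using nonzero by simp
qed

text \<open>The hypothesis is the second kernel condition: it annihilates the coefficient of G(1,y)
  in \<open>kernel_equation\<close>. F(1) occurs only in differences F(x) - F(1) and F(y) - F(1),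
  which the equation of F removes.\<close>

lemma Ghat_1_1:
  assumes "w * y * (x - 1) = x * (y - 1)"
  shows "y * (Ghat 1 1 w - Fhat y + Fhat x) = Fhat x * Fhat y"
proof -
  let ?D = "Fhat x * Fhat y - y * (Ghat 1 1 w - Fhat y + Fhat x)"
  have 1: "(x - 1) * (y - 1) * y - fps_X * x * x * (y - 1) * Ghat 1 1 w
   + fps_X * x * y * (x - 1) * (Fhat y - Fhat 1) - fps_X * x * y * (y - 1) * (Fhat x - Fhat 1) = 0"
    using kernel_equation assms by algebra
  have "(x - 1) * (y - 1) * y * Fhat x * Fhat y - (fps_X * x * Fhat x * Fhat y) * x * (y - 1) * Ghat 1 1 w
    + x * (x - 1) * Fhat x * (fps_X * y * Fhat y * (Fhat y - Fhat 1))
    - y * (y - 1) * Fhat y * (fps_X * x * Fhat x * (Fhat x - Fhat 1)) =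
    ((x - 1) * (y - 1) * y - fps_X * x * x * (y - 1) * Ghat 1 1 w
   + fps_X * x * y * (x - 1) * (Fhat y - Fhat 1) - fps_X * x * y * (y - 1) * (Fhat x - Fhat 1))
    * (Fhat x * Fhat y)"
    by algebra
  also have "\<dots> = 0" unfolding 1 by simp
  also have "fps_X * x * Fhat x * Fhat y = y * (x - 1)" by (simp only: kernel_F)
  also have "fps_X * y * Fhat y * (Fhat y - Fhat 1) = (y - 1) * (Fhat y - y)"
    using Fhat_equation[of y] by (simp add: algebra_simps)
  also have "fps_X * x * Fhat x * (Fhat x - Fhat 1) = (x - 1) * (Fhat x - x)"
    using Fhat_equation[of x] by (simp add: algebra_simps)
  finally have "x * (x - 1) * (y - 1) * ?D = 0" by algebra
  then show ?thesis using nonzero by simp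
qed

end

section \<open>Existence of the substituted series\<close>

lemma kernel_solution_exists:
  fixes z v :: "'a::comm_ring_1 fps"
  assumes "z $ 0 = 0"
  shows "\<exists>u. u $ 0 = 0 \<and> (1 - z) ^ 2 * u = z * (1 + u) * (1 + z * v)"
proof -
  have "\<exists>i. ((1 - z) ^ 2 - z * (1 + z * v)) * i = 1"
    using assms by (intro fps_unit_exists) (simp add: power2_eq_square)
  then obtain i where i: "((1 - z) ^ 2 - z * (1 + z * v)) * i = 1" ..
  have "((1 - z) ^ 2 - z * (1 + z * v)) * (z * (1 + z * v) * i) = z * (1 + z * v)"
    using i by (simp add: mult.left_commute)
  then have "(1 - z) ^ 2 * (z * (1 + z * v) * i) = z * (1 + z * (1 + z * v) * i) * (1 + z * v)"
    by (simp add: algebra_simps)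
  then show ?thesis using assms by (intro exI[of _ "z * (1 + z * v) * i"]) simp
qed

lemma double_kernel_exists:
  fixes z w :: "'a::idom fps"
  assumes z: "z $ 0 = 0"
  shows "\<exists>u v. u $ 0 = 0 \<and> v $ 0 = 0 \<and> (1 - z) ^ 2 * u = z * (1 + u) * (1 + z * v) \<and>
    v * (1 + u) * (1 - 2 * z - z ^ 2 * v) = w * u * (1 + v) * (1 - 2 * z - z ^ 2 * u)"
proof -
  \<comment> \<open>The first condition gives u = z (1 + z v) / D and 1 + u = (1 - z)^2 / D.
    Multiplied by D^2, the second becomes v (1 - z)^2 D (1 - 2 z - z^2 v) = w z (1 + z v) (1 + v)
    ((1 - 2 z) D - z^3 (1 + z v)). The three factors next to v are 1 - z a, 1 - z b and 1 - z c with
    the values below; expanding their product isolates v.\<close>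
  let ?D = "\<lambda>v. (1 - z) * (1 - z) - z * (1 + z * v)"
  let ?a = "2 - z" and ?b = "\<lambda>v. 3 - z + z * v" and ?c = "\<lambda>v. 2 + z * v"
  have "\<exists>v. v = 0 + z * (v * (?a + ?b v + ?c v - z * (?a * ?b v + ?b v * ?c v + ?a * ?c v) + z * z * (?a * ?b v * ?c v))
      + w * (1 + z * v) * (1 + v) * ((1 - 2 * z) * ?D v - z * z * z * (1 + z * v)))"
    using z by (intro fps_fixpoint_exists diff_dvd_intros) simp
  then obtain v where v: "v = 0 + z * (v * (?a + ?b v + ?c v - z * (?a * ?b v + ?b v * ?c v + ?a * ?c v) + z * z * (?a * ?b v * ?c v))
      + w * (1 + z * v) * (1 + v) * ((1 - 2 * z) * ?D v - z * z * z * (1 + z * v)))" ..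
  have v0: "v $ 0 = 0" by (subst v) (simp add: z)
  obtain u where u0: "u $ 0 = 0" and u: "(1 - z) ^ 2 * u = z * (1 + u) * (1 + z * v)"
    using kernel_solution_exists[OF z] by blast
  have D0: "?D v \<noteq> 0" using z by (intro fps_nonzero_if_const) simp
  have 1: "v * (1 - z) ^ 2 * ?D v * (1 - 2 * z - z ^ 2 * v) =
      w * (z * (1 + z * v)) * (1 + v) * ((1 - 2 * z) * ?D v - z * z * z * (1 + z * v))"
    using v by algebra
  have 2: "u * ?D v = z * (1 + z * v)" using u by algebra
  have 3: "(1 + u) * ?D v = (1 - z) ^ 2" using u by algebra
  have "(v * (1 + u) * (1 - 2 * z - z ^ 2 * v)) * (?D v * ?D v) =
      v * ((1 + u) * ?D v) * ?D v * (1 - 2 * z - z ^ 2 * v)" by (simp only: mult_ac)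
  also have "\<dots> = w * (u * ?D v) * (1 + v) * ((1 - 2 * z) * ?D v - z * z * (u * ?D v))"
    unfolding 3 1 2 by (simp only: mult_ac)
  also have "\<dots> = (w * u * (1 + v) * (1 - 2 * z - z ^ 2 * u)) * (?D v * ?D v)"
    by (simp add: algebra_simps power2_eq_square)
  finally have "v * (1 + u) * (1 - 2 * z - z ^ 2 * v) = w * u * (1 + v) * (1 - 2 * z - z ^ 2 * u)"
    using D0 by simp
  then show ?thesis using u0 v0 u by blast
qed

lemma param_exists:
  assumes "tree_param z"
  shows "\<exists>x. is_param z x u"
proof -
  have "\<exists>i. (1 + z * u) * i = 1" using assms by (intro fps_unit_exists) (simp add: tree_param_def)
  then obtain i where i: "(1 + z * u) * i = 1" ..
  have "(1 + u) * i ^ 2 * (1 + z * u) ^ 2 = (1 + u) * ((1 + z * u) * i) ^ 2"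
    by (simp add: power2_eq_square mult_ac)
  then show ?thesis using assms i by (auto simp: is_param_def intro!: exI[of _ "(1 + u) * i ^ 2"])
qed

section \<open>Elimination leading to the cubic\<close>

definition Cpoly_gen :: "'a \<Rightarrow> 'a \<Rightarrow> 'a \<Rightarrow> 'a::comm_ring_1" where
  "Cpoly_gen h z w = w*z*(-1+z)^9*h^3 + (-1+z)^6*(2*w^2*z^2 - w^2*z + 2*z^2 + w - z)*h^2
   - (-1+z)^3*(w^2*z^3 - 3*w^2*z^2 - 2*w*z^3 + w^2*z - 2*w*z^2 + z^3 + 5*w*z - 3*z^2 - 2*w + z)*h
   + 4*w*z^2 - 4*w*z + w"

text \<open>In the unknown \<open>r = (1 - z) u / (1 + u) = z (1 + z v) / (1 - z)\<close> the kernel equations become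
  rational: u, v, w and the value h of the generating function are rational functions of z and r.\<close>

lemma cubic_identity:
  fixes z r w h :: "'a::idom fps"
  assumes h: "h * (z * (1 - z) ^ 3 * r * (1 - r)) = (r - z) * (1 - z - r)"
    and w: "w * (r * (r - z) * (1 - 2 * z - r * (1 - z))) = ((1 - z) * r - z) * (1 - r) * (1 - z - r)"
    and nz: "z \<noteq> 0" "r \<noteq> 0" "1 - r \<noteq> 0" "r - z \<noteq> 0" "1 - 2 * z - r * (1 - z) \<noteq> 0"
  shows "Cpoly_gen h z w = 0" (is "?C = 0")
proof -
  \<comment> \<open>This scaling absorbs all powers of z - 1: the cubic times z^2 is a polynomial in
    H, w and z. Then H = B / A and w = N / E, and the denominators are cleared by A^3 E^2.\<close>
  define H where "H = h * z * (1 - z) ^ 3"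
  define A where "A = r * (1 - r)"
  define E where "E = r * (r - z) * (1 - 2 * z - r * (1 - z))"
  define B where "B = (r - z) * (1 - z - r)"
  define N where "N = ((1 - z) * r - z) * (1 - r) * (1 - z - r)"
  have HA: "H * A = B" using h by (simp add: H_def A_def B_def mult_ac)
  have wE: "w * E = N" using w by (simp add: E_def N_def)
  have "?C * z ^ 2 = - w * H ^ 3 + (2*w^2*z^2 - w^2*z + 2*z^2 + w - z) * H ^ 2
    + z * (w^2*z^3 - 3*w^2*z^2 - 2*w*z^3 + w^2*z - 2*w*z^2 + z^3 + 5*w*z - 3*z^2 - 2*w + z) * H
    + z ^ 2 * (4*w*z^2 - 4*w*z + w)"
    unfolding H_def Cpoly_gen_def by algebra
  then have "?C * z ^ 2 * (A ^ 3 * E ^ 2) = - (w * E) * E * (H * A) ^ 3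
    + (2*(w * E)^2*z^2 - (w * E)^2*z + 2*z^2*E^2 + (w * E) * E - z*E^2) * (H * A) ^ 2 * A
    + z * ((w * E)^2*z^3 - 3*(w * E)^2*z^2 - 2*(w * E)*E*z^3 + (w * E)^2*z - 2*(w * E)*E*z^2 + z^3*E^2
      + 5*(w * E)*E*z - 3*z^2*E^2 - 2*(w * E)*E + z*E^2) * (H * A) * A ^ 2
    + z ^ 2 * (4*(w * E)*E*z^2 - 4*(w * E)*E*z + (w * E)*E) * A ^ 3"
    by algebra
  also have "\<dots> = 0"
    unfolding HA wE unfolding A_def B_def E_def N_def by algebra
  finally have 0: "?C * z ^ 2 * (A ^ 3 * E ^ 2) = 0" .
  have "A \<noteq> 0" "E \<noteq> 0" unfolding A_def E_def using nz by (simp_all only: mult_eq_0_iff simp_thms)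
  then have "C = 0" if "C * z ^ 2 * (A ^ 3 * E ^ 2) = 0" for C
    using that nz(1) by simp
  from this[OF 0] show ?thesis .
qed

context kernel
begin

lemma cubic:
  assumes kernel_v: "v * (1 + u) * (1 - 2 * z - z ^ 2 * v) = w * u * (1 + v) * (1 - 2 * z - z ^ 2 * u)"
    and v0: "v $ 0 = 0"
  defines "h \<equiv> Ghat 1 1 w"
  shows "Cpoly_gen h z w = 0"
proof -
  let ?s = "1 + z * u" and ?t = "1 + z * v" and ?b = "(1 - z) ^ 3"
  let ?P = "1 - 2 * z - z ^ 2 * u" and ?Q = "1 - 2 * z - z ^ 2 * v"
  define c where "c = 1 - z"
  note x = is_param_facts[OF xu] and y = is_param_facts[OF yv]
  have x': "x * ?s ^ 2 = 1 + u" and y': "y * ?t ^ 2 = 1 + v" using xu yv by (auto simp: is_param_def)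
  have c_nz: "c \<noteq> 0" using z_nz by (simp add: c_def)
  obtain i where i: "(1 - z) * i = 1" using fps_unit_exists[of "1 - z"] z by auto
  define r where "r = z * ?t * i"
  have r: "c * r = z * ?t" using i by (simp add: r_def c_def mult.left_commute)
  have r0: "r $ 0 = 0" by (simp add: r_def z)
  have r_nz: "r \<noteq> 0" using r z_nz y(3) by auto
  have r1_nz: "1 - r \<noteq> 0" using r0 by (intro fps_nonzero_if_const) simp
  have e_nz: "1 - 2 * z - r * (1 - z) \<noteq> 0" using r0 z by (intro fps_nonzero_if_const) simp
  have "c * ((1 + u) * r) = c * (c * u)"
    using kernel_u r by (simp add: c_def power2_eq_square) algebra
  then have ru: "(1 + u) * r = c * u" using c_nz by simp
  \<comment> \<open>From here on the quantities of the parametrization are rewritten in z and r;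
    those involving u have denominator 1 - z - r, and v and 1 + v have denominator z^2.\<close>
  have u1: "(1 - z - r) * (1 + u) = c" using ru unfolding c_def by algebra
  have ur: "u * (1 - z - r) = r" using ru unfolding c_def by algebra
  have "?s * (1 - z - r) = (1 - z - r) + z * (u * (1 - z - r))" by algebra
  then have sr: "?s * (1 - z - r) = c * (1 - r)" unfolding ur c_def by algebra
  have "?P * (1 - z - r) = (1 - 2 * z) * (1 - z - r) - z ^ 2 * (u * (1 - z - r))" by algebra
  then have Pr: "?P * (1 - z - r) = c * (1 - 2 * z - r * c)" unfolding ur c_def by algebra
  have v1: "z ^ 2 * (1 + v) = c * (r - z)" using r unfolding c_def by algebra
  have Qr: "?Q = c * (1 - r)" using r unfolding c_def by algebra
  have zv: "z ^ 2 * v = c * r - z" using r by algebra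
  have rz_nz: "r - z \<noteq> 0" using v1 v1_nz z_nz by auto
  have w: "w * (r * (r - z) * (1 - 2 * z - r * c)) = (c * r - z) * (1 - r) * (1 - z - r)"
  proof -
    have "(w * (r * (r - z) * (1 - 2 * z - r * c))) * c ^ 2 =
        w * (u * (1 - z - r)) * (z ^ 2 * (1 + v)) * (?P * (1 - z - r))"
      unfolding ur v1 Pr by (simp add: power2_eq_square mult_ac)
    also have "\<dots> = z ^ 2 * (1 - z - r) * (1 - z - r) * (w * u * (1 + v) * ?P)" by (simp only: mult_ac)
    also have "\<dots> = (z ^ 2 * v) * ((1 - z - r) * (1 + u)) * ?Q * (1 - z - r)"
      unfolding kernel_v[symmetric] by (simp only: mult_ac)
    also have "\<dots> = ((c * r - z) * (1 - r) * (1 - z - r)) * c ^ 2"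
      unfolding u1 Qr unfolding zv by (simp add: power2_eq_square mult_ac)
    finally show ?thesis using c_nz by simp
  qed
  have b: "?b = c ^ 3" by (simp add: c_def)
  have Fx: "Fhat x * ((1 - r) * (1 - z - r) * c ^ 2) = 1 - 2 * z - r * c"
  proof -
    have "Fhat x * ((1 - r) * (1 - z - r) * c ^ 2) * c ^ 2 =
        (Fhat x * ?s * ?b) * (1 - z - r) * (1 - z - r)"
      using sr unfolding b by algebra
    also have "\<dots> = ((1 - z - r) * (1 + u)) * (?P * (1 - z - r))" unfolding x(2) by (simp only: mult_ac)
    also have "\<dots> = (1 - 2 * z - r * c) * c ^ 2" unfolding u1 Pr by (simp add: power2_eq_square mult_ac)
    finally show ?thesis using c_nz by simp
  qed
  have Fy: "Fhat y * (z * r * c ^ 2) = (r - z) * (1 - r)"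
  proof -
    have "Fhat y * (z * r * c ^ 2) * c ^ 2 = (Fhat y * ?t * ?b) * z ^ 2"
      using r unfolding b by algebra
    also have "\<dots> = (r - z) * (1 - r) * c ^ 2"
      unfolding y(2) Qr using v1 by algebra
    finally show ?thesis using c_nz by simp
  qed
  have Fyy: "Fhat y * (z * c) = y * (r * (1 - r))"
  proof -
    have "Fhat y * (z * c) * (?t * c ^ 3) = (Fhat y * ?t * ?b) * (z * c)" unfolding b by (simp only: mult_ac)
    also have "\<dots> = y * (r * (1 - r)) * (?t * c ^ 3)"
      unfolding y(2) Qr y'[symmetric] using r by algebra
    finally show ?thesis using c_nz y(3) by simp
  qed
  \<comment> \<open>\<open>kernel_v\<close> is this relation multiplied by the denominators of x and
    y.\<close>
  have wk: "w * y * (x - 1) = x * (y - 1)"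
  proof -
    have "w * y * (x - 1) * (?s ^ 2 * ?t ^ 2) = w * (y * ?t ^ 2) * ((x - 1) * ?s ^ 2)" by (simp only: mult_ac)
    also have "\<dots> = v * (1 + u) * ?Q" unfolding y' x(1) kernel_v by (simp only: mult_ac)
    also have "\<dots> = (x * ?s ^ 2) * ((y - 1) * ?t ^ 2)" unfolding x' y(1) by (simp only: mult_ac)
    finally show ?thesis using x(3) y(3) by (simp add: mult_ac)
  qed
  \<comment> \<open>By \<open>Fyy\<close> the quotient F(y) / y is a function of z and r, so y
    itself can be cancelled from \<open>Ghat_1_1\<close>.\<close>
  have h1: "z * c * h = (z * c) * Fhat y + Fhat x * (r * (1 - r) - z * c)"
  proof -
    have "y * (z * c * (h - Fhat y + Fhat x)) = z * c * (y * (h - Fhat y + Fhat x))"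
      by (simp only: mult_ac)
    also have "\<dots> = Fhat x * (Fhat y * (z * c))"
      unfolding h_def Ghat_1_1[OF wk] by (simp only: mult_ac)
    also have "\<dots> = y * (Fhat x * (r * (1 - r)))"
      unfolding Fyy by (simp only: mult_ac)
    finally have "z * c * (h - Fhat y + Fhat x) = Fhat x * (r * (1 - r))" using nonzero by simp
    then show ?thesis by (simp add: algebra_simps)
  qed
  have "h * (z * c ^ 3 * r * (1 - r)) = (z * c * h) * (c ^ 2 * r * (1 - r))" by algebra
  also have "\<dots> = (Fhat y * (z * r * c ^ 2)) * c * (1 - r) +
      (Fhat x * ((1 - r) * (1 - z - r) * c ^ 2)) * r * (r - z)"
    unfolding h1 unfolding c_def by algebra
  also have "\<dots> = (r - z) * (1 - z - r)"
    unfolding Fy Fx unfolding c_def by algebra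
  finally have hh: "h * (z * c ^ 3 * r * (1 - r)) = (r - z) * (1 - z - r)" .
  from cubic_identity[OF hh[unfolded c_def] w[unfolded c_def] z_nz(1) r_nz r1_nz rz_nz e_nz]
  show ?thesis .
qed

end

lemma Gser_1_1_cubic:
  fixes z :: "'a::idom fps" and w :: 'a
  assumes z: "tree_param z" and w: "w \<noteq> 0"
  shows "Cpoly_gen (Gser 1 1 w) z (fps_const w) = 0"
proof -
  let ?w = "fps_const w"
  have z0: "z $ 0 = 0" using z by (simp add: tree_param_def)
  obtain u v where uv: "u $ 0 = 0" "v $ 0 = 0" "(1 - z) ^ 2 * u = z * (1 + u) * (1 + z * v)"
    "v * (1 + u) * (1 - 2 * z - z ^ 2 * v) = ?w * u * (1 + v) * (1 - 2 * z - z ^ 2 * u)"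
    using double_kernel_exists[OF z0] by blast
  obtain x y where xy: "is_param z x u" "is_param z y v" using param_exists[OF z] by blast
  have v1: "1 + v \<noteq> 0" using uv by (intro fps_nonzero_if_const) simp
  have "z \<noteq> 0" using z by (auto simp: tree_param_def)
  then have "u \<noteq> 0" using uv(3) is_param_facts(3)[OF xy(2)] by auto
  \<comment> \<open>This is where w is used: v = 0 would mean y = 1, where the factor y - 1 could
    not be cancelled.\<close>
  then have "v \<noteq> 0" using uv(4) w is_param_facts(4)[OF xy(1)] by auto
  then interpret kernel z ?w x y u v
    using uv xy v1 by unfold_locales
  show ?thesis
    using cubic[OF uv(4,2)] Ghat_const[of 1 1 w] by simp
qed

section \<open>Towers of finite field extensions\<close>

locale field_embedding =
  fixes emb :: "'k::field \<Rightarrow> 'l::field"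
  assumes emb_add: "emb (a + b) = emb a + emb b"
    and emb_mult: "emb (a * b) = emb a * emb b"
    and emb_1: "emb 1 = 1"
begin

lemma emb_0: "emb 0 = 0"
  using emb_add[of 0 0] by (metis add_cancel_right_right add_0)

lemma emb_uminus: "emb (- a) = - emb a"
  using emb_add[of a "- a"] by (simp add: emb_0 eq_neg_iff_add_eq_0 add.commute)

sublocale vs: vector_space "\<lambda>c x. emb c * x"
  by unfold_locales (simp_all add: emb_add emb_mult emb_1 algebra_simps)

text \<open>A subring of finite dimension over the embedded base field. Closure under inverses
  follows from the finite dimension, see \<open>finite_ext_inverse\<close>.\<close>

definition finite_ext :: "'l set \<Rightarrow> bool" where
  "finite_ext E \<longleftrightarrow> 1 \<in> E \<and> (\<forall>a\<in>E. \<forall>b\<in>E. a + b \<in> E \<and> a * b \<in> E) \<and> range emb \<subseteq> E \<and>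
     (\<exists>B. finite B \<and> E \<subseteq> vs.span B)"

lemma finite_ext_closed:
  assumes "finite_ext E"
  shows "emb c \<in> E" "0 \<in> E" "1 \<in> E" "a \<in> E \<Longrightarrow> b \<in> E \<Longrightarrow> a + b \<in> E"
    "a \<in> E \<Longrightarrow> b \<in> E \<Longrightarrow> a * b \<in> E" "a \<in> E \<Longrightarrow> - a \<in> E"
    "a \<in> E \<Longrightarrow> b \<in> E \<Longrightarrow> a - b \<in> E" "a \<in> E \<Longrightarrow> a ^ n \<in> E"
proof -
  show 1: "emb c \<in> E" for c using assms by (auto simp: finite_ext_def)
  show "0 \<in> E" using 1[of 0] by (simp add: emb_0)
  show 2: "1 \<in> E" using assms by (auto simp: finite_ext_def)
  show 3: "a \<in> E \<Longrightarrow> b \<in> E \<Longrightarrow> a + b \<in> E" for a b using assms by (auto simp: finite_ext_def)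
  show 4: "a \<in> E \<Longrightarrow> b \<in> E \<Longrightarrow> a * b \<in> E" for a b using assms by (auto simp: finite_ext_def)
  show 5: "a \<in> E \<Longrightarrow> - a \<in> E" for a using 4[OF 1[of "- 1"], of a] by (simp add: emb_uminus emb_1)
  show "a \<in> E \<Longrightarrow> b \<in> E \<Longrightarrow> a - b \<in> E" using 3[of a "- b"] 5[of b] by simp
  show "a \<in> E \<Longrightarrow> a ^ n \<in> E" using 2 4 by (induction n) auto
qed

lemma finite_ext_sum: "finite_ext E \<Longrightarrow> (\<And>i. i \<in> A \<Longrightarrow> f i \<in> E) \<Longrightarrow> sum f A \<in> E"
  by (induction A rule: infinite_finite_induct) (auto intro: finite_ext_closed)

lemma finite_ext_poly: "finite_ext E \<Longrightarrow> (\<And>i. coeff p i \<in> E) \<Longrightarrow> s \<in> E \<Longrightarrow> poly p s \<in> E"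
  unfolding poly_altdef by (intro finite_ext_sum finite_ext_closed)

lemma finite_ext_base: "finite_ext (range emb)"
proof -
  have "emb c \<in> vs.span {1}" for c
    using vs.span_scale[OF vs.span_base[of 1 "{1}"], of c] by simp
  then show ?thesis
    unfolding finite_ext_def
    using emb_1 emb_add emb_mult by (auto intro!: exI[of _ "{1}"] simp flip: emb_add emb_mult)
qed

text \<open>The span of \<open>B\<close> cannot contain \<open>card B + 1\<close> independent powers
  of s. Linear dependence speaks of sets, so two equal powers form a case of their own.\<close>

lemma finite_ext_algebraic:
  assumes E: "finite_ext E" and s: "s \<in> E"
  shows "\<exists>p :: 'k poly. p \<noteq> 0 \<and> poly (map_poly emb p) s = 0"
proof -
  obtain B where B: "finite B" "E \<subseteq> vs.span B" using E by (auto simp: finite_ext_def)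
  let ?n = "card B"
  have poly: "poly (map_poly emb p) s = (\<Sum>i\<le>n. emb (coeff p i) * s ^ i)" if "degree p \<le> n" for p n
  proof -
    have "degree (map_poly emb p) \<le> n"
      using that by (intro degree_le) (simp add: coeff_map_poly emb_0 coeff_eq_0)
    then have "poly (map_poly emb p) s = (\<Sum>i\<le>n. coeff (map_poly emb p) i * s ^ i)"
      unfolding poly_altdef by (intro sum.mono_neutral_left) (auto simp: coeff_eq_0)
    then show ?thesis by (simp add: coeff_map_poly emb_0)
  qed
  show ?thesis
  proof (cases "inj_on (\<lambda>i. s ^ i) {..?n}")
    case False
    then obtain i j where ij: "i \<noteq> j" "s ^ i = s ^ j" by (auto simp: inj_on_def)
    let ?p = "monom 1 i - monom 1 j :: 'k poly"
    have "coeff ?p i = 1" using ij by simp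
    then have "?p \<noteq> 0" by (metis coeff_0 zero_neq_one)
    moreover have "map_poly emb ?p = monom 1 i - monom 1 j"
      using ij by (auto simp: poly_eq_iff coeff_map_poly emb_0 emb_1 emb_uminus)
    then have "poly (map_poly emb ?p) s = 0" using ij by (simp add: poly_monom)
    ultimately show ?thesis by (intro exI[of _ ?p] conjI)
  next
    case True
    let ?S = "(\<lambda>i. s ^ i) ` {..?n}"
    have "?S \<subseteq> vs.span B" using B(2) finite_ext_closed(8)[OF E s] by (auto intro: subsetD)
    moreover have "card ?S = Suc ?n" using True by (simp add: card_image)
    ultimately have "vs.dependent ?S" using vs.independent_span_bound[OF B(1), of ?S] by auto
    then obtain c where c: "\<exists>b\<in>?S. c b \<noteq> 0" "(\<Sum>b\<in>?S. emb (c b) * b) = 0"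
      using vs.dependent_finite[of ?S] by auto
    define p where "p = (\<Sum>i\<le>?n. monom (c (s ^ i)) i)"
    have coeff: "coeff p i = (if i \<le> ?n then c (s ^ i) else 0)" for i
      by (simp add: p_def coeff_sum)
    have nz: "p \<noteq> 0"
    proof
      assume "p = 0"
      then have "c (s ^ i) = 0" if "i \<le> ?n" for i using coeff[of i] that by simp
      with c(1) show False by auto
    qed
    have "degree p \<le> ?n" by (rule degree_le) (simp add: coeff)
    then have "poly (map_poly emb p) s = (\<Sum>i\<le>?n. emb (c (s ^ i)) * s ^ i)"
      by (simp add: poly coeff)
    also have "\<dots> = 0" using c(2) by (subst (asm) sum.reindex[OF True]) simp
    finally have "poly (map_poly emb p) s = 0" .
    with nz show ?thesis by (intro exI[of _ p] conjI)
  qed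
qed

text \<open>An annihilating polynomial of least degree has a nonzero constant coefficient, since
  otherwise s could be divided out; this coefficient expresses 1/s as a polynomial in s.\<close>

lemma finite_ext_inverse:
  assumes E: "finite_ext E" and s: "s \<in> E"
  shows "inverse s \<in> E"
proof (cases "s = 0")
  case False
  obtain p where p: "p \<noteq> 0" "poly (map_poly emb p) s = 0"
    and min: "\<And>q. q \<noteq> 0 \<Longrightarrow> poly (map_poly emb q) s = 0 \<Longrightarrow> degree p \<le> degree q"
    using finite_ext_algebraic[OF assms]
      ex_has_least_nat[of "\<lambda>p. p \<noteq> 0 \<and> poly (map_poly emb p) s = 0" _ degree] by blast
  obtain a q where aq: "p = pCons a q" by (cases p)
  have eq: "emb a + s * poly (map_poly emb q) s = 0"
    using p aq by (simp add: map_poly_pCons emb_0)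
  have "a \<noteq> 0"
  proof
    assume a: "a = 0"
    then have "q \<noteq> 0" "poly (map_poly emb q) s = 0" using p aq eq False by (auto simp: emb_0)
    then have "degree p \<le> degree q" by (rule min)
    then show False using aq \<open>q \<noteq> 0\<close> by simp
  qed
  have "emb a * emb (inverse a) = 1" using \<open>a \<noteq> 0\<close> by (simp add: emb_1 flip: emb_mult)
  with eq have "s * - (poly (map_poly emb q) s * emb (inverse a)) = 1" by algebra
  then have "inverse s = - (poly (map_poly emb q) s * emb (inverse a))"
    by (rule inverse_unique)
  moreover have "poly (map_poly emb q) s \<in> E"
    by (intro finite_ext_poly[OF E] s) (simp add: coeff_map_poly emb_0 finite_ext_closed[OF E])
  ultimately show ?thesis using finite_ext_closed[OF E] by simp
qed (use finite_ext_closed[OF E] in simp)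

text \<open>The extension is E[s]. The equation of s reduces every power to exponents below
  \<open>n\<close>, so the products of elements of \<open>B\<close> with these powers span
  it.\<close>

lemma finite_ext_adjoin_root:
  assumes E: "finite_ext E" and p: "p \<noteq> 0" "\<And>i. coeff p i \<in> E" "poly p s = 0"
  shows "\<exists>E'. finite_ext E' \<and> E \<subseteq> E' \<and> s \<in> E'"
proof -
  obtain B where B: "finite B" "E \<subseteq> vs.span B" using E by (auto simp: finite_ext_def)
  define n where "n = degree p"
  define c where "c i = - coeff p i * inverse (lead_coeff p)" for i
  have c: "c i \<in> E" for i
    unfolding c_def using finite_ext_closed[OF E] finite_ext_inverse[OF E] p by simp
  have "(\<Sum>i<n. coeff p i * s ^ i) + lead_coeff p * s ^ n = 0"
    using p(3) unfolding poly_altdef n_def by (simp add: lessThan_Suc_atMost[symmetric])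
  then have "s ^ n = - (\<Sum>i<n. coeff p i * s ^ i) * inverse (lead_coeff p)"
    using p(1) by (simp add: field_simps eq_neg_iff_add_eq_0)
  then have sn: "s ^ n = (\<Sum>i<n. c i * s ^ i)"
    by (simp add: c_def sum_distrib_left sum_negf mult_ac)
  define W where "W = vs.span ((\<lambda>(b, i). b * s ^ i) ` (B \<times> {..<n}))"
  have W: "e * s ^ m \<in> W" if "e \<in> E" for e m
    using that
  proof (induction m arbitrary: e rule: less_induct)
    case (less m)
    show ?case
    proof (cases "m < n")
      case True
      have "e \<in> vs.span B" using less(2) B by blast
      then show ?thesis
      proof (induction rule: vs.span_induct_alt)
        case base
        then show ?case by (simp add: W_def vs.span_zero)
      next
        case (step k b y)
        have "b * s ^ m \<in> W" unfolding W_def using step True by (intro vs.span_base) auto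
        then have "emb k * (b * s ^ m) \<in> W" unfolding W_def by (rule vs.span_scale)
        with step(2) have "emb k * (b * s ^ m) + y * s ^ m \<in> W"
          unfolding W_def by (intro vs.span_add)
        then show ?case by (simp add: algebra_simps)
      qed
    next
      case False
      then obtain k where k: "m = n + k" using le_Suc_ex by (metis not_less)
      have "e * s ^ m = (\<Sum>i<n. (e * c i) * s ^ (i + k))"
        by (simp add: k power_add sn sum_distrib_left sum_distrib_right mult_ac)
      also have "\<dots> \<in> W"
        unfolding W_def
      proof (intro vs.span_sum)
        fix i assume "i \<in> {..<n}"
        then show "e * c i * s ^ (i + k) \<in> vs.span ((\<lambda>(b, i). b * s ^ i) ` (B \<times> {..<n}))"
          using less(1)[of "i + k" "e * c i"] less(2) c k finite_ext_closed[OF E] by (simp add: W_def)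
      qed
      finally show ?thesis .
    qed
  qed
  define E' where "E' = {poly q s | q. \<forall>i. coeff q i \<in> E}"
  have sub: "E' \<subseteq> W"
  proof
    fix a assume "a \<in> E'"
    then obtain q where "a = poly q s" "\<forall>i. coeff q i \<in> E" by (auto simp: E'_def)
    then show "a \<in> W"
      unfolding poly_altdef using W by (auto simp: W_def intro!: vs.span_sum)
  qed
  have incl: "E \<subseteq> E'"
  proof
    fix a assume "a \<in> E"
    then show "a \<in> E'"
      unfolding E'_def using finite_ext_closed[OF E]
      by (auto intro!: exI[of _ "[:a:]"] simp: coeff_pCons split: nat.split)
  qed
  have root: "s \<in> E'"
    unfolding E'_def using finite_ext_closed[OF E]
    by (auto intro!: exI[of _ "[:0, 1:]"] simp: coeff_pCons split: nat.split)
  have closed: "a + b \<in> E' \<and> a * b \<in> E'" if "a \<in> E'" "b \<in> E'" for a b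
  proof -
    obtain q r where qr: "a = poly q s" "\<forall>i. coeff q i \<in> E" "b = poly r s" "\<forall>i. coeff r i \<in> E"
      using \<open>a \<in> E'\<close> \<open>b \<in> E'\<close> by (auto simp: E'_def)
    have "a + b = poly (q + r) s" "\<forall>i. coeff (q + r) i \<in> E"
      using qr finite_ext_closed[OF E] by auto
    moreover have "a * b = poly (q * r) s" "\<forall>i. coeff (q * r) i \<in> E"
      using qr finite_ext_closed[OF E] by (auto simp: coeff_mult intro!: finite_ext_sum[OF E])
    ultimately show ?thesis unfolding E'_def by blast
  qed
  have "finite ((\<lambda>(b, i). b * s ^ i) ` (B \<times> {..<n}))" using B by simp
  then have "\<exists>B. finite B \<and> E' \<subseteq> vs.span B" using sub unfolding W_def by (intro exI conjI)
  moreover have "1 \<in> E'" "range emb \<subseteq> E'" using incl finite_ext_closed(1,3)[OF E] by auto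
  ultimately have "finite_ext E'" using closed unfolding finite_ext_def by simp
  with incl root show ?thesis by (intro exI[of _ E'] conjI)
qed

end

text \<open>Only meaningful if f is an injective ring homomorphism.\<close>

definition fract_map :: "('a::idom \<Rightarrow> 'b::idom) \<Rightarrow> 'a fract \<Rightarrow> 'b fract" where
  "fract_map f q = (SOME y. \<exists>a b. b \<noteq> 0 \<and> q = Fract a b \<and> y = Fract (f a) (f b))"

context
  fixes f :: "'a::idom \<Rightarrow> 'b::idom"
  assumes f_add: "\<And>a b. f (a + b) = f a + f b" and f_mult: "\<And>a b. f (a * b) = f a * f b"
    and f_1: "f 1 = 1" and f_0: "\<And>a. f a = 0 \<longleftrightarrow> a = 0"
begin

lemma fract_map_Fract: "b \<noteq> 0 \<Longrightarrow> fract_map f (Fract a b) = Fract (f a) (f b)"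
  unfolding fract_map_def
proof (rule someI2)
  assume "b \<noteq> 0"
  then show "\<exists>a' b'. b' \<noteq> 0 \<and> Fract a b = Fract a' b' \<and> Fract (f a) (f b) = Fract (f a') (f b')"
    by blast
  fix y assume "\<exists>a' b'. b' \<noteq> 0 \<and> Fract a b = Fract a' b' \<and> y = Fract (f a') (f b')"
  then obtain a' b' where *: "b' \<noteq> 0" "Fract a b = Fract a' b'" "y = Fract (f a') (f b')" by blast
  then have "a * b' = a' * b" using \<open>b \<noteq> 0\<close> by (simp add: eq_fract)
  then have "f a * f b' = f a' * f b" by (simp flip: f_mult)
  then show "y = Fract (f a) (f b)" using * \<open>b \<noteq> 0\<close> by (simp add: eq_fract f_0)
qed

lemma field_embedding_fract_map: "field_embedding (fract_map f)"
proof
  fix p q :: "'a fract"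
  show "fract_map f (p + q) = fract_map f p + fract_map f q"
    by (cases p, cases q) (simp add: fract_map_Fract f_0 f_add f_mult)
  show "fract_map f (p * q) = fract_map f p * fract_map f q"
    by (cases p, cases q) (simp add: fract_map_Fract f_0 f_mult)
  show "fract_map f 1 = 1" by (simp add: One_fract_def fract_map_Fract f_1)
qed

lemma fract_map_to_fract: "fract_map f (to_fract a) = to_fract (f a)"
  by (simp add: to_fract_def fract_map_Fract f_1)

end

interpretation fps_emb: field_embedding "fract_map (fps_of_poly :: 'a::idom poly \<Rightarrow> 'a fps)"
  by (rule field_embedding_fract_map)
    (simp_all add: fps_of_poly_add fps_of_poly_mult fps_of_poly_eq_iff flip: fps_of_poly_0)

lemma fract_map_fps_of_poly: "fract_map fps_of_poly (to_fract p) = to_fract (fps_of_poly (p :: 'a::idom poly))"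
  by (rule fract_map_to_fract)
    (simp_all add: fps_of_poly_add fps_of_poly_mult fps_of_poly_eq_iff flip: fps_of_poly_0)

text \<open>Series lying in a common finite extension of the field of rational functions in t.\<close>

definition alg_ring :: "'a::idom fps set \<Rightarrow> bool" where
  "alg_ring M \<longleftrightarrow> (\<exists>E. fps_emb.finite_ext E \<and> M = {f. to_fract f \<in> E})"

lemma alg_ring_exists: "\<exists>M :: 'a::idom fps set. alg_ring M"
  unfolding alg_ring_def using fps_emb.finite_ext_base by blast

lemma alg_ring_closed:
  assumes "alg_ring M"
  shows "fps_of_poly p \<in> M" "a \<in> M \<Longrightarrow> b \<in> M \<Longrightarrow> a + b \<in> M" "a \<in> M \<Longrightarrow> b \<in> M \<Longrightarrow> a - b \<in> M"
    "a \<in> M \<Longrightarrow> b \<in> M \<Longrightarrow> a * b \<in> M" "a \<in> M \<Longrightarrow> - a \<in> M" "a \<in> M \<Longrightarrow> a ^ n \<in> M"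
    "0 \<in> M" "1 \<in> M" "numeral k \<in> M" "fps_const r \<in> M" "fps_X \<in> M"
proof -
  obtain E where E: "fps_emb.finite_ext E" "M = {f. to_fract f \<in> E}" using assms by (auto simp: alg_ring_def)
  note closed = fps_emb.finite_ext_closed[OF E(1)]
  show 1: "fps_of_poly p \<in> M" for p
    using closed(1)[of "to_fract p"] by (simp add: E fract_map_fps_of_poly)
  show "a \<in> M \<Longrightarrow> b \<in> M \<Longrightarrow> a + b \<in> M" "a \<in> M \<Longrightarrow> b \<in> M \<Longrightarrow> a - b \<in> M" "a \<in> M \<Longrightarrow> - a \<in> M"
    "a \<in> M \<Longrightarrow> b \<in> M \<Longrightarrow> a * b \<in> M" for a b using closed by (auto simp: E)
  then show "a \<in> M \<Longrightarrow> a ^ n \<in> M" using 1[of 1] by (induction n) auto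
  show "0 \<in> M" "1 \<in> M" "numeral k \<in> M" "fps_const r \<in> M" "fps_X \<in> M"
    using 1[of 0] 1[of 1] 1[of "numeral k"] 1[of "[:r:]"] 1[of "[:0, 1:]"]
    by (simp_all add: fps_of_poly_const)
qed

text \<open>The quotient is taken in the fraction field, so \<open>a\<close> may be a nonunit such
  as a multiple of t; that the quotient is a series is known beforehand, being
  \<open>f\<close>.\<close>

lemma alg_ring_divide:
  assumes "alg_ring M" "a * f = b" "a \<in> M" "b \<in> M" "a \<noteq> 0"
  shows "f \<in> M"
proof -
  obtain E where E: "fps_emb.finite_ext E" "M = {f. to_fract f \<in> E}" using assms by (auto simp: alg_ring_def)
  have "to_fract a * to_fract f = to_fract b" using assms(2) by (simp flip: to_fract_mult)
  then have "to_fract f = to_fract b * inverse (to_fract a)" using assms(5) by (simp add: field_simps)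
  then show "f \<in> M"
    using assms fps_emb.finite_ext_closed(5)[OF E(1)] fps_emb.finite_ext_inverse[OF E(1)] by (simp add: E)
qed

lemma poly_to_fract: "poly (fract_poly p) (to_fract x) = to_fract (poly p x)"
  by (induction p) (simp_all add: map_poly_pCons)

lemma alg_ring_adjoin_root:
  assumes "alg_ring M" "p \<noteq> 0" "\<And>i. coeff p i \<in> M" "poly p f = 0"
  shows "\<exists>M'. alg_ring M' \<and> M \<subseteq> M' \<and> f \<in> M'"
proof -
  obtain E where E: "fps_emb.finite_ext E" "M = {f. to_fract f \<in> E}" using assms by (auto simp: alg_ring_def)
  have "\<exists>E'. fps_emb.finite_ext E' \<and> E \<subseteq> E' \<and> to_fract f \<in> E'"
    using assms by (intro fps_emb.finite_ext_adjoin_root[OF E(1), of "fract_poly p"])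
      (auto simp: poly_to_fract coeff_map_poly E)
  then show ?thesis unfolding alg_ring_def E by blast
qed

lemma alg_ring_algebraic:
  fixes f :: "'a::{factorial_ring_gcd, semiring_gcd_mult_normalize} fps"
  assumes "alg_ring M" "f \<in> M"
  shows "algebraic_fps f"
proof -
  let ?emb = "fract_map (fps_of_poly :: 'a poly \<Rightarrow> 'a fps)"
  obtain E where E: "fps_emb.finite_ext E" "M = {f. to_fract f \<in> E}" using assms by (auto simp: alg_ring_def)
  then obtain p where p: "p \<noteq> 0" "poly (map_poly ?emb p) (to_fract f) = 0"
    using fps_emb.finite_ext_algebraic[OF E(1), of "to_fract f"] assms by auto
  \<comment> \<open>The coefficients of \<open>p\<close> are fractions, whereas
    \<open>algebraic_fps\<close> asks for polynomials in t. Splitting off the content clears the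
    denominators, which is what the gcd structure on the coefficients serves.\<close>
  define q where "q = primitive_part_fract p"
  define c where "c = fract_content p"
  have pq: "smult c (fract_poly q) = p" unfolding c_def q_def by (rule content_times_primitive_part_fract)
  have "q \<noteq> 0" using p(1) pq by auto
  have "map_poly ?emb (fract_poly q) = fract_poly (map_poly fps_of_poly q)"
    by (simp add: poly_eq_iff coeff_map_poly fps_emb.emb_0 fract_map_fps_of_poly)
  then have "map_poly ?emb p = smult (?emb c) (fract_poly (map_poly fps_of_poly q))"
    unfolding pq[symmetric] by (auto simp: poly_eq_iff coeff_map_poly fps_emb.emb_0 fps_emb.emb_mult)
  then have "?emb c * to_fract (poly (map_poly fps_of_poly q) f) = 0"
    using p(2) by (simp add: poly_to_fract)
  moreover have "?emb c \<noteq> 0"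
  proof
    assume "?emb c = 0"
    moreover have "?emb c * ?emb (inverse c) = 1"
      using p(1) pq by (auto simp: fps_emb.emb_1 simp flip: fps_emb.emb_mult)
    ultimately show False by simp
  qed
  ultimately have "poly (map_poly fps_of_poly q) f = 0" by simp
  then show ?thesis unfolding algebraic_fps_def using \<open>q \<noteq> 0\<close> by blast
qed

section \<open>Algebraicity of the generating function\<close>

lemma coeff_mem_intros:
  "0 \<in> M \<Longrightarrow> \<forall>i. coeff 0 i \<in> M"
  "a \<in> M \<Longrightarrow> \<forall>i. coeff p i \<in> M \<Longrightarrow> \<forall>i. coeff (pCons a p) i \<in> M"
  by (auto simp: coeff_pCons split: nat.split)

lemma alg_ring_tree_param:
  assumes "alg_ring M" "tree_param z"
  shows "\<exists>M'. alg_ring M' \<and> M \<subseteq> M' \<and> z \<in> M'"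
proof -
  let ?p = "[:fps_X, - 1, 3, - 3, 1:]"
  have "poly ?p z = fps_X - z * (1 - z) ^ 3"
    by (simp add: algebra_simps power3_eq_cube)
  then have root: "poly ?p z = 0" using assms(2) by (simp add: tree_param_def)
  have mem: "\<forall>i. coeff ?p i \<in> M"
    by (intro coeff_mem_intros alg_ring_closed[OF assms(1)])
  show ?thesis by (rule alg_ring_adjoin_root[OF assms(1) _ mem[rule_format] root]) simp
qed

lemma alg_ring_param:
  assumes M: "alg_ring M" and z: "z \<in> M" and xu: "is_param z x u" and x: "x \<in> M" "x \<noteq> 1"
  shows "\<exists>M'. alg_ring M' \<and> M \<subseteq> M' \<and> u \<in> M'"
proof -
  let ?p = "[:x - 1, 2 * x * z - 1, x * z ^ 2:]"
  have "poly ?p u = x * (1 + z * u) ^ 2 - (1 + u)"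
    by (simp add: algebra_simps power2_eq_square)
  also have "\<dots> = 0" using xu by (simp add: is_param_def)
  finally have root: "poly ?p u = 0" .
  have mem: "\<forall>i. coeff ?p i \<in> M"
    by (intro coeff_mem_intros alg_ring_closed[OF M] x(1) z)
  show ?thesis by (rule alg_ring_adjoin_root[OF M _ mem[rule_format] root]) (use x(2) in simp)
qed

lemma alg_ring_Fhat:
  assumes M: "alg_ring M" and z: "z \<in> M" "u \<in> M" and xu: "is_param z x u"
  shows "Fhat x \<in> M"
proof (rule alg_ring_divide[OF M])
  have z0: "z $ 0 = 0" using xu by (simp add: is_param_def tree_param_def)
  show "((1 + z * u) * (1 - z) ^ 3) * Fhat x = (1 + u) * (1 - 2 * z - z ^ 2 * u)"
    using is_param_facts(2)[OF xu] by (simp only: mult_ac)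
  show "(1 + z * u) * (1 - z) ^ 3 \<in> M" "(1 + u) * (1 - 2 * z - z ^ 2 * u) \<in> M"
    by (intro alg_ring_closed[OF M] z)+
  show "(1 + z * u) * (1 - z) ^ 3 \<noteq> 0" using z0 by (intro fps_nonzero_if_const) (simp add: power3_eq_cube)
qed

text \<open>The opposite direction to \<open>param_exists\<close>: the series x is given, and u is
  found by contraction.\<close>

lemma param_of_series_exists:
  assumes z: "tree_param z"
  shows "\<exists>u. is_param z x u"
proof -
  have "\<exists>u. u = (x - 1) + z * (x * (u + u) + x * z * u * u)"
    using z by (intro fps_fixpoint_exists diff_dvd_intros) (simp add: tree_param_def)
  then obtain u where u: "u = (x - 1) + z * (x * (u + u) + x * z * u * u)" ..
  have "x * (1 + z * u) ^ 2 = 1 + ((x - 1) + z * (x * (u + u) + x * z * u * u))"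
    by (simp add: algebra_simps power2_eq_square)
  then have "x * (1 + z * u) ^ 2 = 1 + u" by (simp only: u[symmetric])
  with z show ?thesis by (auto simp: is_param_def)
qed

lemma Gser_algebraic:
  fixes x y w :: "'a::{factorial_ring_gcd, semiring_gcd_mult_normalize}"
  assumes x: "x \<noteq> 1" and y: "y \<noteq> 0" "y \<noteq> 1" and w: "w \<noteq> 0"
  shows "algebraic_fps (Gser x y w)"
proof -
  define X Y V where XYV: "X = fps_const x" "Y = fps_const y" "V = fps_const w"
  have X1: "X \<noteq> 1" and Y0: "Y \<noteq> 0" and Y1: "Y \<noteq> 1" and V0: "V \<noteq> 0"
    using x y w by (auto simp: XYV fps_eq_iff)
  obtain z :: "'a fps" where z: "tree_param z" using tree_param_exists ..
  have z0: "z $ 0 = 0" and z_nz: "z \<noteq> 0" using z by (auto simp: tree_param_def)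
  obtain u where u: "is_param z X u" using param_of_series_exists[OF z] ..
  obtain v where v: "is_param z Y v" using param_of_series_exists[OF z] ..
  define h where "h = Gser 1 1 w"
  obtain M0 :: "'a fps set" where M0: "alg_ring M0" using alg_ring_exists ..
  obtain M1 where M1: "alg_ring M1" "z \<in> M1" using alg_ring_tree_param[OF M0 z] by blast
  obtain M2 where M2: "alg_ring M2" "z \<in> M2" "u \<in> M2"
    using alg_ring_param[OF M1 u _ X1] alg_ring_closed(10)[OF M1(1)] M1(2) by (auto simp: XYV)
  obtain M3 where M3: "alg_ring M3" "z \<in> M3" "u \<in> M3" "v \<in> M3"
    using alg_ring_param[OF M2(1,2) v _ Y1] alg_ring_closed(10)[OF M2(1)] M2 by (auto simp: XYV)
  obtain M where M: "alg_ring M" "z \<in> M" "u \<in> M" "v \<in> M" "h \<in> M"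
  proof -
    let ?p = "[:4*V*z^2 - 4*V*z + V,
      - ((-1+z)^3*(V^2*z^3 - 3*V^2*z^2 - 2*V*z^3 + V^2*z - 2*V*z^2 + z^3 + 5*V*z - 3*z^2 - 2*V + z)),
      (-1+z)^6*(2*V^2*z^2 - V^2*z + 2*z^2 + V - z), V*z*(-1+z)^9:]"
    have "poly ?p h = Cpoly_gen h z V"
      by (simp add: Cpoly_gen_def algebra_simps power2_eq_square power3_eq_cube)
    also have "\<dots> = 0" using Gser_1_1_cubic[OF z w] by (simp add: h_def XYV)
    finally have root: "poly ?p h = 0" .
    have "V \<in> M3" using alg_ring_closed(10)[OF M3(1)] by (simp add: XYV)
    then have mem: "\<forall>i. coeff ?p i \<in> M3"
      by (intro coeff_mem_intros alg_ring_closed[OF M3(1)] M3(2))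
    have "(-1 + z) \<noteq> 0" using z0 by auto
    then have "?p \<noteq> 0" using z_nz V0 by simp
    from alg_ring_adjoin_root[OF M3(1) this mem[rule_format] root]
    obtain M' where "alg_ring M'" "M3 \<subseteq> M'" "h \<in> M'" by blast
    then show ?thesis using M3 by (intro that[of M']) auto
  qed
  note closed = alg_ring_closed[OF M(1)] and divide = alg_ring_divide[OF M(1)]
  have XM: "X \<in> M" "Y \<in> M" "V \<in> M" using closed(10) by (auto simp: XYV)
  have FX: "Fser x \<in> M" using alg_ring_Fhat[OF M(1,2,3) u] by (simp add: XYV Fhat_const)
  have FY: "Fhat Y \<in> M" using alg_ring_Fhat[OF M(1,2,4) v] .
  have F1: "Fhat 1 \<in> M"
    using alg_ring_Fhat[OF M(1,2) closed(7), of 1] z by (simp add: is_param_def)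
  \<comment> \<open>While \<open>u\<close> parametrizes the given x, \<open>u'\<close> parametrizes
    the series that replaces x in order to cancel the kernel at the given y. Only this condition is
    imposed; G(1,1) is already known from the cubic.\<close>
  obtain u' where u': "u' $ 0 = 0" "(1 - z) ^ 2 * u' = z * (1 + u') * (1 + z * v)"
    using kernel_solution_exists[OF z0] by blast
  obtain X' where X': "is_param z X' u'" using param_exists[OF z] by blast
  have Yv: "Y * (1 + z * v) ^ 2 = 1 + v" using v by (simp add: is_param_def)
  have "v \<noteq> 0" using Yv Y1 by auto
  moreover have "1 + v \<noteq> 0" using Yv Y0 is_param_facts(3)[OF v] by auto
  ultimately interpret kernel z V X' Y u' v
    using u' X' v by unfold_locales
  have u'M: "u' \<in> M"
  proof (rule divide)
    show "((1 - z) ^ 2 - z * (1 + z * v)) * u' = z * (1 + z * v)" using u'(2) by algebra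
    show "(1 - z) ^ 2 - z * (1 + z * v) \<noteq> 0"
      using z0 by (intro fps_nonzero_if_const) (simp add: power2_eq_square)
  qed (intro closed M)+
  have X'M: "X' \<in> M"
  proof (rule divide)
    show "(1 + z * u') ^ 2 * X' = 1 + u'" using X' by (simp add: is_param_def mult.commute)
    show "(1 + z * u') ^ 2 \<noteq> 0" using is_param_facts(3)[OF X'] by simp
  qed (intro closed M u'M)+
  have FX': "Fhat X' \<in> M" using alg_ring_Fhat[OF M(1,2) u'M X'] .
  have hG: "Ghat 1 1 V = h" using Ghat_const[of 1 1 w] by (simp add: h_def XYV)
  have gM: "Ghat 1 Y V \<in> M"
  proof (rule divide)
    show "(fps_X * X' * (V * Y * (X' - 1) - X' * (Y - 1))) * Ghat 1 Y V =
       fps_X * V * X' * Y * (X' - 1) * h - (X' - 1) * (Y - 1) * Y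
       - fps_X * X' * Y * (X' - 1) * (Fhat Y - Fhat 1) + fps_X * X' * Y * (Y - 1) * (Fhat X' - Fhat 1)"
      using kernel_equation unfolding hG by algebra
    \<comment> \<open>X' has constant coefficient 1, so the term with w vanishes at t = 0 and the
      second kernel starts with 1 - y, which is nonzero.\<close>
    have "(X' * (1 + z * u') ^ 2) $ 0 = (1 + u') $ 0" using X' by (simp add: is_param_def)
    then have "X' $ 0 = 1" using z0 u'(1) by (simp add: power2_eq_square)
    then have "(V * Y * (X' - 1) - X' * (Y - 1)) $ 0 = 1 - y" by (simp add: XYV)
    then have "V * Y * (X' - 1) - X' * (Y - 1) \<noteq> 0" using y by (metis eq_iff_diff_eq_0 fps_zero_nth)
    then show "fps_X * X' * (V * Y * (X' - 1) - X' * (Y - 1)) \<noteq> 0" using nonzero by simp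
  qed (intro closed M XM X'M FX' FY F1)+
  have "Gser x y w \<in> M"
  proof (rule divide)
    let ?c = "Y * (X - 1) * (Y - 1) - fps_X * X * X * (Y - 1) * Fhat Y
      - fps_X * X * Y * (Y - 1) * (Fser x - Fhat 1)"
    have F: "Fhat Y = Fser y" "Fhat 1 = Fser 1" "Ghat 1 Y V = Gser 1 y w"
      using Fhat_const[of y] Fhat_const[of 1] Ghat_const[of 1 y w] by (simp_all add: XYV)
    show "?c * Gser x y w = (X - 1) * (Y - 1) * Y * Fhat Y
      + fps_X * V * X * Y * (X - 1) * Fhat Y * (Ghat 1 Y V - h)
      - fps_X * X * X * (Y - 1) * Fhat Y * Ghat 1 Y V
      + fps_X * X * Y * (X - 1) * Fhat Y * (Fhat Y - Fhat 1)
      - fps_X * X * Y * (Y - 1) * (Fser x - Fhat 1) * Fhat Y"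
      using Gser_equation[of y x w] unfolding F h_def XYV[symmetric] by algebra
    have "?c $ 0 = y * (x - 1) * (y - 1)" by (simp add: XYV)
    then show "?c \<noteq> 0" using x y by (metis eq_iff_diff_eq_0 fps_zero_nth mult_eq_0_iff)
  qed (intro closed M XM FX FY F1 gM)+
  then show ?thesis using alg_ring_algebraic M(1) by blast
qed

lemma Gfun_eq: "Gfun = Gser varX varY varW"
  unfolding Gfun_def Gser_def gf_def
proof (intro arg_cong[of _ _ Abs_fps] ext sum.cong refl)
  fix n s assume "s \<in> intervals n"
  then show "(case s of (P, Q) \<Rightarrow> \<Sum>i = 0..2 * n. varW ^ nat (height P i) * varX ^ contacts_lt P i * varY ^ contacts_ge P i)
      = (case s of (P, Q) \<Rightarrow> pointed_weight varX varY varW P)"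
    by (auto simp: intervals_eq pointed_weight_def)
qed

lemma G11_eq: "G11 = Gser 1 1 [:0, 1:]"
proof -
  have "G11 = poly_coeffs 1 (poly_coeffs 1 Gfun)"
    by (simp add: G11_def poly_coeffs_def fps_eq_iff)
  also have "\<dots> = Gser 1 1 [:0, 1:]"
    unfolding Gfun_eq Gser_def poly_coeffs_gf
    by (intro arg_cong[of _ _ gf] ext) (simp add: pointed_weight_def poly_sum varX_def varY_def varW_def)
  finally show ?thesis .
qed

theorem theorem3p2:
  shows "algebraic_fps Gfun \<and>
         (\<exists>z :: int poly fps. fps_nth z 0 = 0 \<and> z * (1 - z) ^ 3 = fps_X) \<and>
         (\<forall>z :: int poly fps. fps_nth z 0 = 0 \<and> z * (1 - z) ^ 3 = fps_X \<longrightarrow>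
             Cpoly G11 z (fps_const [:0, 1:]) = 0)"
proof (intro conjI allI impI)
  show "algebraic_fps Gfun"
    unfolding Gfun_eq
    by (rule Gser_algebraic) (simp_all add: varX_def varY_def varW_def one_pCons)
  show "\<exists>z :: int poly fps. fps_nth z 0 = 0 \<and> z * (1 - z) ^ 3 = fps_X"
    using tree_param_exists by (simp add: tree_param_def)
  fix z :: "int poly fps" assume "fps_nth z 0 = 0 \<and> z * (1 - z) ^ 3 = fps_X"
  then have "tree_param z" by (simp add: tree_param_def)
  then show "Cpoly G11 z (fps_const [:0, 1:]) = 0"
    using Gser_1_1_cubic[of z "[:0, 1:]"] by (simp add: G11_eq Cpoly_def Cpoly_gen_def)
qed

end
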